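(* Let $n\ge 2$. For $a>0$, the $n$-dimensional catenoid $\mathcal{C}_a$ in $\mathbb{H}^n\times\mathbb{R}$ has infinite volume and finite total extrinsic curvature $\int_{\mathcal{C}_a}|A_a|^n\,d\mu_a$. When $n=2$, the catenoid $\mathcal{C}_a$ has infinite total intrinsic curvature $\int_{\mathcal{C}_a}|K_a|\,d\mu_a$.
   Context: $\mathbb{H}^n$ is hyperbolic space in the ball model $\mathbb{B}=\{x\in\mathbb{R}^n:|x|<1\}$ with metric $\big(\frac{2}{1-|x|^2}\big)^2(dx_1^2+\cdots+dx_n^2)$, and $\mathbb{H}^n\times\mathbb{R}$ carries the product metric with $dt^2$. For $a>0$, let $f(a,\cdot)$, defined on a symmetric interval $]-T(a),T(a)[$ with $0<T(a)<\infty$, be the maximal solution of $f_{tt}=(n-1)\coth(f)(1+f_t^2)$, $f(0)=a$, $f_t(0)=0$. The catenoid $\mathcal{C}_a$ is the complete minimal hypersurface of revolution about $\{0\}\times\mathbb{R}$ given by the image of $(t,\xi)\in\,]-T(a),T(a)[\,\times S^{n-1}\mapsto(\tanh(f(a,t)/2)\,\xi,\,t)$. $A_a$ is the second fundamental form of $\mathcal{C}_a$ relative to a unit normal, $d\mu_a$ is its Riemannian measure, and, when $n=2$, $K_a$ is its Gauss curvature. *)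

theory Defs
  imports "HOL-Analysis.Analysis"
begin

section \<open>Riemannian metrics on open subsets of a Euclidean space\<close>

text \<open>
  A Riemannian metric is given by its values \<open>g p u v\<close> at a point p on tangent vectors u, v.
  All notions below are local, so the values of g outside the open set of interest are irrelevant.
\<close>

type_synonym 'a riem_metric = "'a \<Rightarrow> 'a \<Rightarrow> 'a \<Rightarrow> real"

text \<open>
  The Christoffel symbols of the Levi-Civita connection as a vector-valued bilinear form, given by
  the Koszul formula for constant vector fields. Thus
  \<open>\<nabla>\<^sub>u Y = D\<^sub>u Y + christoffel g p u (Y p)\<close>.
\<close>

definition christoffel :: "'a::euclidean_space riem_metric \<Rightarrow> 'a \<Rightarrow> 'a \<Rightarrow> 'a \<Rightarrow> 'a" where
  "christoffel g p u v = (THE z. \<forall>w. 2 * g p z w =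
      frechet_derivative (\<lambda>q. g q v w) (at p) u
    + frechet_derivative (\<lambda>q. g q u w) (at p) v
    - frechet_derivative (\<lambda>q. g q u v) (at p) w)"

text \<open>
  \<open>R(u,v)w = \<nabla>\<^sub>u \<nabla>\<^sub>v w - \<nabla>\<^sub>v \<nabla>\<^sub>u w\<close> for constant (hence commuting) vector fields u, v, w.
\<close>

definition riemann_curvature ::
    "'a::euclidean_space riem_metric \<Rightarrow> 'a \<Rightarrow> 'a \<Rightarrow> 'a \<Rightarrow> 'a \<Rightarrow> 'a" where
  "riemann_curvature g p u v w =
      frechet_derivative (\<lambda>q. christoffel g q v w) (at p) u
    - frechet_derivative (\<lambda>q. christoffel g q u w) (at p) v
    + christoffel g p u (christoffel g p v w)
    - christoffel g p v (christoffel g p u w)"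

definition sectional_curvature :: "'a::euclidean_space riem_metric \<Rightarrow> 'a \<Rightarrow> 'a \<Rightarrow> 'a \<Rightarrow> real" where
  "sectional_curvature g p u v =
     g p (riemann_curvature g p u v v) u / (g p u u * g p v v - (g p u v)\<^sup>2)"

text \<open>
  Gauss curvature of a metric on an open subset of the plane (meaningful only for
  \<open>CARD('n) = 2\<close>): the sectional curvature of the plane spanned by the two coordinate vectors.
  It does not depend on the order in which they are picked.
\<close>

definition gauss_curvature :: "(real^'n) riem_metric \<Rightarrow> real^'n \<Rightarrow> real" where
  "gauss_curvature g x =
     (let (i, j) = (SOME (i, j). i \<noteq> j) in sectional_curvature g x (axis i 1) (axis j 1))"

definition gram_matrix :: "(real^'n \<Rightarrow> real^'n \<Rightarrow> real) \<Rightarrow> real^'n^'n" where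
  "gram_matrix b = (\<chi> i j. b (axis i 1) (axis j 1))"


section \<open>Parametrized hypersurfaces\<close>

text \<open>
  Throughout, \<open>\<phi>\<close> is a global parametrization of a hypersurface \<open>\<phi> ` U\<close>: a smooth injective immersion
  of an open subset U of \<open>real^'n\<close> into an ambient Euclidean space carrying the metric G.
  Geometric quantities are computed in the coordinates given by \<open>\<phi>\<close> and transported to the
  hypersurface \<open>\<phi> ` U\<close>.
\<close>

definition pullback_metric ::
    "'b::euclidean_space riem_metric \<Rightarrow> ('a::euclidean_space \<Rightarrow> 'b) \<Rightarrow> 'a riem_metric" where
  "pullback_metric G \<phi> x u v =
     G (\<phi> x) (frechet_derivative \<phi> (at x) u) (frechet_derivative \<phi> (at x) v)"

definition riemannian_measure ::
    "'b::euclidean_space riem_metric \<Rightarrow> (real^'n) set \<Rightarrow> (real^'n \<Rightarrow> 'b) \<Rightarrow> 'b measure" where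
  "riemannian_measure G U \<phi> =
     distr (density (restrict_space lborel U)
             (\<lambda>x. ennreal (sqrt (det (gram_matrix (pullback_metric G \<phi> x))))))
           (restrict_space borel (\<phi> ` U)) \<phi>"

definition unit_normal ::
    "'b::euclidean_space riem_metric \<Rightarrow> (real^'n) set \<Rightarrow> (real^'n \<Rightarrow> 'b) \<Rightarrow> ('b \<Rightarrow> 'b) \<Rightarrow> bool" where
  "unit_normal G U \<phi> \<nu> \<longleftrightarrow> (\<forall>x\<in>U. G (\<phi> x) (\<nu> (\<phi> x)) (\<nu> (\<phi> x)) = 1 \<and>
     (\<forall>u. G (\<phi> x) (frechet_derivative \<phi> (at x) u) (\<nu> (\<phi> x)) = 0))"

text \<open>
  \<open>A(u,v) = G(\<nabla>\<^bsub>d\<phi>(u)\<^esub> (d\<phi>(v)), \<nu>)\<close>, on coordinate vectors u, v, where \<open>\<nabla>\<close> is the Levi-Civita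
  connection of G and v is extended to a constant field.
\<close>

definition second_fundamental_form ::
    "'b::euclidean_space riem_metric \<Rightarrow> (real^'n \<Rightarrow> 'b) \<Rightarrow> ('b \<Rightarrow> 'b) \<Rightarrow>
     real^'n \<Rightarrow> real^'n \<Rightarrow> real^'n \<Rightarrow> real" where
  "second_fundamental_form G \<phi> \<nu> x u v =
     G (\<phi> x)
       (frechet_derivative (\<lambda>y. frechet_derivative \<phi> (at y) v) (at x) u
        + christoffel G (\<phi> x) (frechet_derivative \<phi> (at x) u) (frechet_derivative \<phi> (at x) v))
       (\<nu> (\<phi> x))"

text \<open>
  The norm of A with respect to the induced metric g:
  \<open>|A|\<^sup>2 = g\<^bsup>ik\<^esup> g\<^bsup>jl\<^esup> A\<^bsub>ij\<^esub> A\<^bsub>kl\<^esub> = tr (S\<^sup>2)\<close>, where \<open>S = g\<^bsup>-1\<^esup> A\<close> is the shape operator.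
\<close>

definition sff_norm ::
    "'b::euclidean_space riem_metric \<Rightarrow> (real^'n) set \<Rightarrow> (real^'n \<Rightarrow> 'b) \<Rightarrow> ('b \<Rightarrow> 'b) \<Rightarrow> 'b \<Rightarrow> real" where
  "sff_norm G U \<phi> \<nu> p =
     (let x = the_inv_into U \<phi> p;
          S = matrix_inv (gram_matrix (pullback_metric G \<phi> x)) **
              gram_matrix (second_fundamental_form G \<phi> \<nu> x)
      in sqrt (trace (S ** S)))"

definition surface_gauss_curvature ::
    "'b::euclidean_space riem_metric \<Rightarrow> (real^'n) set \<Rightarrow> (real^'n \<Rightarrow> 'b) \<Rightarrow> 'b \<Rightarrow> real" where
  "surface_gauss_curvature G U \<phi> p =
     gauss_curvature (pullback_metric G \<phi>) (the_inv_into U \<phi> p)"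


section \<open>Catenoids in the product of hyperbolic space and the line\<close>

text \<open>The ball model; only points (x, t) with \<open>norm x < 1\<close> are relevant.\<close>

definition hyp_line_metric :: "((real^'n) \<times> real) riem_metric" where
  "hyp_line_metric p u v =
     (2 / (1 - (norm (fst p))\<^sup>2))\<^sup>2 * (fst u \<bullet> fst v) + snd u * snd v"

text \<open>
  Solutions of the initial value problem on an interval I. As coth is undefined at 0, a solution
  with \<open>f 0 = a > 0\<close> stays positive.
\<close>

definition profile_solution :: "nat \<Rightarrow> real \<Rightarrow> real set \<Rightarrow> (real \<Rightarrow> real) \<Rightarrow> bool" where
  "profile_solution n a I f \<longleftrightarrow> f 0 = a \<and> (\<exists>f'. f' 0 = 0 \<and>
     (\<forall>t\<in>I. f t > 0 \<and> (f has_real_derivative f' t) (at t) \<and>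
       (f' has_real_derivative
          (real n - 1) * (cosh (f t) / sinh (f t)) * (1 + (f' t)\<^sup>2)) (at t)))"

definition maximal_profile :: "nat \<Rightarrow> real \<Rightarrow> real \<Rightarrow> (real \<Rightarrow> real) \<Rightarrow> bool" where
  "maximal_profile n a T f \<longleftrightarrow> profile_solution n a {-T<..<T} f \<and>
     (\<forall>J h. open J \<and> connected J \<and> {-T<..<T} \<subseteq> J \<and> profile_solution n a J h \<and>
        (\<forall>t\<in>{-T<..<T}. h t = f t) \<longrightarrow> J = {-T<..<T})"

definition catenoid_map :: "(real \<Rightarrow> real) \<Rightarrow> real \<times> (real^'n) \<Rightarrow> (real^'n) \<times> real" where
  "catenoid_map f = (\<lambda>(t, \<xi>). (tanh (f t / 2) *\<^sub>R \<xi>, t))"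

definition catenoid :: "real \<Rightarrow> (real \<Rightarrow> real) \<Rightarrow> ((real^'n) \<times> real) set" where
  "catenoid T f = catenoid_map f ` ({-T<..<T} \<times> sphere 0 1)"

text \<open>
  The manifold \<open>]-T,T[ \<times> S\<^bsup>n-1\<^esup>\<close> is diffeomorphic to the open annulus \<open>e\<^bsup>-T\<^esup> < |y| < e\<^bsup>T\<^esup>\<close> in
  n-space via polar coordinates \<open>y = e\<^bsup>t\<^esup> \<xi>\<close>, which yields a global coordinate system on the catenoid.
\<close>

definition annulus :: "real \<Rightarrow> (real^'n) set" where
  "annulus T = {y. exp (-T) < norm y \<and> norm y < exp T}"

definition log_polar :: "real^'n \<Rightarrow> real \<times> (real^'n)" where
  "log_polar y = (ln (norm y), y /\<^sub>R norm y)"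

definition catenoid_chart :: "(real \<Rightarrow> real) \<Rightarrow> real^'n \<Rightarrow> (real^'n) \<times> real" where
  "catenoid_chart f = catenoid_map f \<circ> log_polar"

lemma annulus_norm_pos: "y \<in> annulus T \<Longrightarrow> norm y > 0"
  unfolding annulus_def using exp_gt_zero less_trans by blast

lemma bij_betw_log_polar: "bij_betw log_polar (annulus T) ({-T<..<T} \<times> sphere (0::real^'n) 1)"
proof (rule bij_betw_byWitness[where f' = "\<lambda>(t, \<xi>). exp t *\<^sub>R \<xi>"])
  show "\<forall>y\<in>annulus T. (\<lambda>(t, \<xi>). exp t *\<^sub>R \<xi>) (log_polar y) = (y::real^'n)"
    using annulus_norm_pos by (force simp: log_polar_def)
  show "\<forall>z\<in>{-T<..<T} \<times> sphere (0::real^'n) 1. log_polar ((\<lambda>(t, \<xi>). exp t *\<^sub>R \<xi>) z) = z"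
    by (auto simp: log_polar_def)
  show "log_polar ` annulus T \<subseteq> {-T<..<T} \<times> sphere (0::real^'n) 1"
  proof (rule image_subsetI)
    fix y :: "real^'n" assume y: "y \<in> annulus T"
    then have "norm y > 0" by (rule annulus_norm_pos)
    moreover have "- T < ln (norm y)"
      using y \<open>norm y > 0\<close> by (subst exp_less_cancel_iff[symmetric]) (simp add: annulus_def)
    moreover have "ln (norm y) < T"
      using y \<open>norm y > 0\<close> by (subst exp_less_cancel_iff[symmetric]) (simp add: annulus_def)
    ultimately show "log_polar y \<in> {-T<..<T} \<times> sphere (0::real^'n) 1"
      by (auto simp: log_polar_def)
  qed
  show "(\<lambda>(t, \<xi>). exp t *\<^sub>R \<xi>) ` ({-T<..<T} \<times> sphere (0::real^'n) 1) \<subseteq> annulus T"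
    by (auto simp: annulus_def)
qed

lemma catenoid_chart_image:
  "catenoid_chart f ` (annulus T :: (real^'n) set) = catenoid T f"
  using bij_betw_log_polar[where 'n = 'n and T = T]
  by (metis bij_betw_imp_surj_on catenoid_chart_def catenoid_def image_comp)

lemma catenoid_chart_inj:
  assumes "profile_solution n a {-T<..<T} f"
  shows "inj_on (catenoid_chart f) (annulus T :: (real^'n) set)"
proof -
  have "inj_on (catenoid_map f) ({-T<..<T} \<times> sphere (0::real^'n) 1)"
    using assms by (force simp: inj_on_def catenoid_map_def profile_solution_def)
  then show ?thesis
    using bij_betw_log_polar[where 'n = 'n and T = T]
    unfolding catenoid_chart_def bij_betw_def by (metis comp_inj_on)
qed

definition catenoid_measure :: "real \<Rightarrow> (real \<Rightarrow> real) \<Rightarrow> ((real^'n) \<times> real) measure" where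
  "catenoid_measure T f = riemannian_measure hyp_line_metric (annulus T) (catenoid_chart f)"

definition catenoid_unit_normal ::
    "real \<Rightarrow> (real \<Rightarrow> real) \<Rightarrow> ((real^'n) \<times> real \<Rightarrow> (real^'n) \<times> real) \<Rightarrow> bool" where
  "catenoid_unit_normal T f = unit_normal hyp_line_metric (annulus T) (catenoid_chart f)"

definition catenoid_sff_norm ::
    "real \<Rightarrow> (real \<Rightarrow> real) \<Rightarrow> ((real^'n) \<times> real \<Rightarrow> (real^'n) \<times> real) \<Rightarrow>
     (real^'n) \<times> real \<Rightarrow> real" where
  "catenoid_sff_norm T f = sff_norm hyp_line_metric (annulus T) (catenoid_chart f)"

definition catenoid_gauss_curvature ::
    "real \<Rightarrow> (real \<Rightarrow> real) \<Rightarrow> (real^'n) \<times> real \<Rightarrow> real" where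
  "catenoid_gauss_curvature T f =
     surface_gauss_curvature hyp_line_metric (annulus T) (catenoid_chart f)"

end

theory Submission
  imports Defs
begin

text \<open>
  Write n for the dimension, \<open>k = n - 1\<close>, and \<open>t = ln |y|\<close> in the annulus chart. The induced metric is
  \<open>(1 + f'\<^sup>2) dt\<^sup>2 + sinh\<^sup>2 f d\<xi>\<^sup>2\<close> (\<open>pullback_metric_chart\<close>), and the principal curvatures are, up to sign,
  \<open>coth f / (1 + f'\<^sup>2)\<^bsup>1/2\<^esup>\<close> with multiplicity k and \<open>f'' / (1 + f'\<^sup>2)\<^bsup>3/2\<^esup>\<close> (\<open>sff_norm_chart\<close>). All
  these tensors are invariant under orthogonal maps, hence of the form \<open>\<alpha> (u \<bullet> v) + \<beta> (u \<bullet> y)(v \<bullet> y)\<close>, for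
  which determinants and traces are explicit.

  The profile equation has the first integral \<open>1 + f'\<^sup>2 = (sinh f / sinh a)\<^bsup>2k\<^esup>\<close>. Two consequences carry
  the proof. First, \<open>f \<ge> a\<close>. Second, the equation reduces on \<open>]0,T[\<close> to an autonomous equation of
  first order that is solved by inverting an integral; so a bounded solution would extend beyond T,
  and maximality forces f to be unbounded on \<open>]0,T[\<close> (\<open>profile_unbounded\<close>).

  Extrinsic curvature: the density of the volume times \<open>|A|\<^sup>n\<close> is a constant times
  \<open>coth\<^sup>n f (sinh f)\<^bsup>2k - kn\<^esup> / |y|\<^sup>n\<close>. As \<open>2k \<le> kn\<close> and \<open>f \<ge> a\<close>, it is bounded on the
  bounded annulus, hence integrable.

  Volume: as f is unbounded, for every \<open>x > a\<close> there is a shell on which f runs from x to \<open>x + 1\<close>. Its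
  thickness in t is at least \<open>(sinh a / sinh (x + 1))\<^sup>k\<close>, while the density is at least a constant times
  \<open>(sinh x)\<^bsup>2k\<^esup>\<close>. So the volume of the single shell already tends to infinity with x (\<open>shell_volume\<close>).

  Intrinsic curvature: for \<open>n = 2\<close> the metric is \<open>sinh\<^sup>2 f (dt\<^sup>2 / sinh\<^sup>2 a + d\<xi>\<^sup>2)\<close>, with Gauss curvature
  \<open>-(1 + sinh\<^sup>2 a / sinh\<^sup>4 f)\<close> (\<open>gauss_curvature_catenoid\<close>). Its absolute value is at least 1, so its
  integral is at least the volume.
\<close>

section \<open>Rotationally symmetric bilinear forms\<close>

text \<open>
  The bilinear form \<open>\<alpha> (u \<bullet> v) + \<beta> (u \<bullet> y)(v \<bullet> y)\<close>. For \<open>y \<noteq> 0\<close> it is the general symmetric form that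
  is invariant under the linear isometries fixing y, with \<open>\<alpha>\<close> the factor on the orthogonal complement of y
  and \<open>\<alpha> + \<beta> (y \<bullet> y)\<close> the factor on the line through y.
\<close>

definition radial_form :: "real \<Rightarrow> real \<Rightarrow> 'a::real_inner \<Rightarrow> 'a \<Rightarrow> 'a \<Rightarrow> real" where
  "radial_form \<alpha> \<beta> y u v = \<alpha> * (u \<bullet> v) + \<beta> * ((u \<bullet> y) * (v \<bullet> y))"

lemma gram_radial_form_component:
  "gram_matrix (radial_form \<alpha> \<beta> y) $ i $ j = (if i = j then \<alpha> else 0) + \<beta> * (y $ i * y $ j)"
  for y :: "real^'n"
  by (simp add: gram_matrix_def radial_form_def inner_axis_axis inner_axis')
     (simp add: axis_def)

lemma gram_radial_form_mult_vec:
  "gram_matrix (radial_form \<alpha> \<beta> y) *v x = \<alpha> *\<^sub>R x + (\<beta> * (y \<bullet> x)) *\<^sub>R y"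
  for y :: "real^'n"
proof (subst vec_eq_iff, intro allI)
  fix i
  have "(gram_matrix (radial_form \<alpha> \<beta> y) *v x) $ i =
      (\<Sum>j\<in>UNIV. (if i = j then \<alpha> else 0) * x $ j) + (\<Sum>j\<in>UNIV. \<beta> * (y $ i * y $ j) * x $ j)"
    by (simp add: matrix_vector_mult_def gram_radial_form_component distrib_right sum.distrib)
  also have "(\<Sum>j\<in>UNIV. (if i = j then \<alpha> else 0) * x $ j) = \<alpha> * x $ i"
    by (simp add: mult_delta_left)
  also have "(\<Sum>j\<in>UNIV. \<beta> * (y $ i * y $ j) * x $ j) = \<beta> * (y \<bullet> x) * y $ i"
    by (simp add: inner_vec_def sum_distrib_left sum_distrib_right mult_ac)
  finally show "(gram_matrix (radial_form \<alpha> \<beta> y) *v x) $ i =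
      (\<alpha> *\<^sub>R x + (\<beta> * (y \<bullet> x)) *\<^sub>R y) $ i" by simp
qed

lemma gram_radial_form_mult:
  "gram_matrix (radial_form \<alpha> \<beta> y) ** gram_matrix (radial_form \<gamma> \<delta> y) =
     gram_matrix (radial_form (\<alpha> * \<gamma>) (\<alpha> * \<delta> + \<beta> * \<gamma> + \<beta> * \<delta> * (y \<bullet> y)) y)"
  for y :: "real^'n"
  by (simp add: matrix_eq matrix_vector_mul_assoc[symmetric] gram_radial_form_mult_vec
      inner_add_right algebra_simps)

lemma trace_gram_radial_form:
  "trace (gram_matrix (radial_form \<alpha> \<beta> y)) = real CARD('n) * \<alpha> + \<beta> * (y \<bullet> y)"
  for y :: "real^'n"
  by (simp add: trace_def gram_radial_form_component sum.distrib inner_vec_def sum_distrib_left)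

text \<open>The determinant is computed after rotating y onto a coordinate axis, where the matrix is diagonal.\<close>

lemma det_gram_radial_form:
  fixes y :: "real^'n"
  shows "det (gram_matrix (radial_form \<alpha> \<beta> y)) = \<alpha> ^ (CARD('n) - 1) * (\<alpha> + \<beta> * (y \<bullet> y))"
proof -
  let ?k = "undefined :: 'n"
  have "norm (norm y *\<^sub>R axis ?k (1::real)) = norm y" by simp
  then obtain h :: "real^'n \<Rightarrow> real^'n" where h: "orthogonal_transformation h" "h (norm y *\<^sub>R axis ?k 1) = y"
    by (rule orthogonal_transformation_exists)
  define Q where "Q = matrix h"
  define z where "z = norm y *\<^sub>R axis ?k (1::real)"
  have Q: "orthogonal_matrix Q" "Q *v x = h x" for x
    using h(1) orthogonal_transformation_matrix[of h] unfolding Q_def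
    by (auto simp: matrix_works orthogonal_transformation_linear)
  have QQ: "transpose Q *v (Q *v x) = x" for x
    using Q(1) by (simp add: matrix_vector_mul_assoc orthogonal_matrix)
  have Qz: "Q *v z = y" using h(2) Q by (simp add: z_def)
  have Qy: "transpose Q *v y = z" using QQ[of z] Qz by simp
  have "transpose Q ** gram_matrix (radial_form \<alpha> \<beta> y) ** Q = gram_matrix (radial_form \<alpha> \<beta> z)"
  proof (subst matrix_eq, intro allI)
    fix x
    have "y \<bullet> (Q *v x) = z \<bullet> x"
      by (metis Qy dot_lmul_matrix transpose_matrix_vector transpose_transpose)
    then show "(transpose Q ** gram_matrix (radial_form \<alpha> \<beta> y) ** Q) *v x
        = gram_matrix (radial_form \<alpha> \<beta> z) *v x"
      by (simp add: matrix_vector_mul_assoc[symmetric] gram_radial_form_mult_vec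
          matrix_vector_right_distrib matrix_vector_mult_scaleR QQ Qy
          del: transpose_matrix_vector)
  qed
  moreover have "det Q * det Q = 1"
    using Q(1) by (metis det_I det_mul det_transpose orthogonal_matrix)
  ultimately have "det (gram_matrix (radial_form \<alpha> \<beta> y)) = det (gram_matrix (radial_form \<alpha> \<beta> z))"
    by (metis (no_types, lifting) det_mul det_transpose mult.assoc mult.commute mult_1)
  also have "\<dots> = (\<Prod>i\<in>UNIV. gram_matrix (radial_form \<alpha> \<beta> z) $ i $ i)"
    by (rule det_diagonal) (auto simp: gram_radial_form_component z_def axis_def)
  also have "\<dots> = (\<Prod>i\<in>UNIV. if i = ?k then \<alpha> + \<beta> * (y \<bullet> y) else \<alpha>)"
    by (rule prod.cong)
      (auto simp: gram_radial_form_component z_def axis_def dot_square_norm power2_eq_square)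
  also have "\<dots> = \<alpha> ^ (CARD('n) - 1) * (\<alpha> + \<beta> * (y \<bullet> y))"
    by (subst prod.remove[of _ ?k]) (auto simp: card_Diff_singleton)
  finally show ?thesis .
qed

text \<open>
  For a first fundamental form (E, F) and a second fundamental form (A, B), the shape operator is
  again radial, with principal curvature \<open>A / E\<close> of multiplicity \<open>n - 1\<close> and one radial principal
  curvature.
\<close>

lemma trace_square_relative_radial_form:
  fixes y :: "real^'n" and A B E F :: real
  assumes "E \<noteq> 0" "E + F * (y \<bullet> y) \<noteq> 0"
  defines "S \<equiv> matrix_inv (gram_matrix (radial_form E F y)) ** gram_matrix (radial_form A B y)"
  shows "trace (S ** S) =
    (real CARD('n) - 1) * (A / E)\<^sup>2 + ((A + B * (y \<bullet> y)) / (E + F * (y \<bullet> y)))\<^sup>2"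
proof -
  define s where "s = y \<bullet> y"
  \<comment> \<open>S is the form (x, z), where (E, F) times (x, z) is (A, B)\<close>
  define x where "x = A / E"
  define z where "z = (B - F * x) / (E + F * s)"
  let ?G = "gram_matrix (radial_form E F y)"
  have nz: "E + F * s \<noteq> 0" using assms by (simp add: s_def)
  have "invertible ?G"
    using assms by (simp add: invertible_det_nz det_gram_radial_form)
  then have inv: "matrix_inv ?G ** ?G = mat 1"
    by (simp add: invertible_def matrix_inv_def) (metis (mono_tags, lifting) someI_ex)
  have Ex: "E * x = A" using assms by (simp add: x_def)
  have Ez: "E * z + F * x + F * z * s = B"
  proof -
    have "(E + F * s) * z = B - F * x" using nz by (simp add: z_def)
    then show ?thesis by (simp add: algebra_simps)
  qed
  have "?G ** gram_matrix (radial_form x z y) = gram_matrix (radial_form A B y)"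
    using Ex Ez by (simp add: gram_radial_form_mult s_def)
  then have "S = matrix_inv ?G ** (?G ** gram_matrix (radial_form x z y))"
    by (simp add: S_def)
  also have "\<dots> = gram_matrix (radial_form x z y)"
    by (simp add: matrix_mul_assoc inv)
  finally have S: "S = gram_matrix (radial_form x z y)" .
  have "x + z * s = (A + B * s) / (E + F * s)"
    unfolding z_def Ex[symmetric] using nz by (simp add: divide_simps) (simp add: algebra_simps)
  moreover have "trace (S ** S) = (real CARD('n) - 1) * x\<^sup>2 + (x + z * s)\<^sup>2"
    by (simp add: S gram_radial_form_mult trace_gram_radial_form s_def[symmetric]
        power2_eq_square algebra_simps)
  ultimately show ?thesis by (simp add: x_def s_def)
qed

section \<open>Derivatives of radial functions\<close>

lemma frechet_derivative_cong_open:
  assumes "open U" "x \<in> U" "\<And>y. y \<in> U \<Longrightarrow> f y = g y"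
  shows "frechet_derivative f (at x) = frechet_derivative g (at x)"
proof -
  have "(f has_derivative D) (at x) \<longleftrightarrow> (g has_derivative D) (at x)" for D
    using assms by (metis has_derivative_transform_within_open)
  then show ?thesis by (simp add: frechet_derivative_def)
qed

lemma has_derivative_ln_norm:
  fixes y :: "'a::real_inner"
  assumes "y \<noteq> 0"
  shows "((\<lambda>y. ln (norm y)) has_derivative (\<lambda>u. (u \<bullet> y) / (y \<bullet> y))) (at y)"
proof -
  have "((\<lambda>y. ln (y \<bullet> y) / 2) has_derivative (\<lambda>u. (u \<bullet> y) / (y \<bullet> y))) (at y)"
    using assms by (auto intro!: derivative_eq_intros simp: inner_commute field_simps fun_eq_iff)
  then show ?thesis
    by (rule has_derivative_transform_within_open[of _ _ _ _ "- {0}"])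
      (use assms in \<open>auto simp: norm_eq_sqrt_inner ln_sqrt\<close>)
qed

lemma has_derivative_of_ln_norm:
  fixes y :: "'a::real_inner"
  assumes "y \<noteq> 0" "(\<psi> has_real_derivative d) (at (ln (norm y)))"
  shows "((\<lambda>y. \<psi> (ln (norm y))) has_derivative (\<lambda>u. d * ((u \<bullet> y) / (y \<bullet> y)))) (at y)"
  using has_derivative_compose[OF has_derivative_ln_norm[OF assms(1)]
      assms(2)[THEN has_field_derivative_imp_has_derivative]]
  by simp

lemma has_derivative_inner_ratio:
  fixes y v :: "'a::real_inner"
  assumes "y \<noteq> 0"
  shows "((\<lambda>y. (v \<bullet> y) / (y \<bullet> y)) has_derivative
     (\<lambda>u. (u \<bullet> v) / (y \<bullet> y) - 2 * ((u \<bullet> y) * (v \<bullet> y)) / (y \<bullet> y)\<^sup>2)) (at y)"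
  using assms
  by (auto intro!: derivative_eq_intros simp: inner_commute field_simps fun_eq_iff power2_eq_square)

lemma exp_ln_norm:
  fixes y :: "'a::real_inner"
  assumes "y \<noteq> 0"
  shows "exp (- 2 * ln (norm y)) = 1 / (y \<bullet> y)" "exp (- 4 * ln (norm y)) = (1 / (y \<bullet> y))\<^sup>2"
proof -
  have "exp (- 2 * ln (norm y)) = inverse (exp (ln (norm y)) ^ 2)"
    by (simp add: exp_minus exp_double)
  then show 1: "exp (- 2 * ln (norm y)) = 1 / (y \<bullet> y)"
    using assms by (simp add: dot_square_norm divide_inverse)
  have "exp (- 4 * ln (norm y)) = (exp (- 2 * ln (norm y)))\<^sup>2"
    by (simp add: exp_double[symmetric])
  then show "exp (- 4 * ln (norm y)) = (1 / (y \<bullet> y))\<^sup>2" unfolding 1 .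
qed

section \<open>The Levi-Civita connection of the ambient space\<close>

text \<open>A positive definite metric has at most one solution of the Koszul formula.\<close>

lemma christoffel_eqI:
  assumes diff: "\<And>x y w. g p (x - y) w = g p x w - g p y w"
    and pos: "\<And>x. x \<noteq> 0 \<Longrightarrow> g p x x > 0"
    and koszul: "\<And>w. 2 * g p z w =
      frechet_derivative (\<lambda>q. g q v w) (at p) u
    + frechet_derivative (\<lambda>q. g q u w) (at p) v
    - frechet_derivative (\<lambda>q. g q u v) (at p) w"
  shows "christoffel g p u v = z"
  unfolding christoffel_def
proof (rule the_equality)
  fix x assume x: "\<forall>w. 2 * g p x w = frechet_derivative (\<lambda>q. g q v w) (at p) u
    + frechet_derivative (\<lambda>q. g q u w) (at p) v - frechet_derivative (\<lambda>q. g q u v) (at p) w"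
  have "2 * g p x w = 2 * g p z w" for w using x koszul by metis
  then have "g p (x - z) (x - z) = 0" by (simp add: diff)
  then show "x = z" using pos[of "x - z"] by auto
qed (use koszul in blast)

lemma hyp_line_metric_inner:
  "hyp_line_metric p u v = (2 / (1 - fst p \<bullet> fst p))\<^sup>2 * (fst u \<bullet> fst v) + snd u * snd v"
  by (simp add: hyp_line_metric_def dot_square_norm)

lemma has_derivative_hyp_line_metric:
  fixes p :: "(real^'n) \<times> real"
  assumes "norm (fst p) < 1"
  shows "((\<lambda>q. hyp_line_metric q v w) has_derivative
    (\<lambda>u. 2 * (2 / (1 - fst p \<bullet> fst p)) ^ 3 * (fst u \<bullet> fst p) * (fst v \<bullet> fst w))) (at p)"
proof -
  have "fst p \<bullet> fst p < 1" using assms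
    by (metis dot_square_norm norm_ge_zero one_power2 power_strict_mono zero_neq_numeral
        bot_nat_0.not_eq_extremum)
  then have nz: "1 - fst p \<bullet> fst p \<noteq> 0" by simp
  have fd: "(fst has_derivative fst) (at p)" by (rule has_derivative_fst[OF has_derivative_ident])
  have in_s: "((\<lambda>q. fst q \<bullet> fst q) has_derivative (\<lambda>u. 2 * (fst u \<bullet> fst p))) (at p)"
    by (auto intro!: derivative_eq_intros fd simp: inner_commute)
  have "((\<lambda>s. 2 / (1 - s)) has_real_derivative 2 / (1 - s)\<^sup>2) (at s)" if "1 - s \<noteq> 0" for s :: real
    using that by (auto intro!: derivative_eq_intros simp: power2_eq_square)
  from DERIV_power[OF this[OF nz], of 2]
  have "((\<lambda>s. (2 / (1 - s))\<^sup>2) has_real_derivative (2 / (1 - fst p \<bullet> fst p)) ^ 3) (at (fst p \<bullet> fst p))"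
    using nz by (simp add: power2_eq_square power3_eq_cube)
  from has_derivative_compose[OF in_s this[THEN has_field_derivative_imp_has_derivative]]
  have "((\<lambda>q. (2 / (1 - fst q \<bullet> fst q))\<^sup>2 * (fst v \<bullet> fst w) + snd v * snd w) has_derivative
    (\<lambda>u. 2 * (2 / (1 - fst p \<bullet> fst p)) ^ 3 * (fst u \<bullet> fst p) * (fst v \<bullet> fst w))) (at p)"
    by (intro has_derivative_eq_rhs[OF has_derivative_add_const[OF has_derivative_mult_left]])
      (auto simp: fun_eq_iff)
  then show ?thesis by (simp add: hyp_line_metric_inner)
qed

lemma christoffel_hyp_line_metric:
  fixes p u v :: "(real^'n) \<times> real"
  assumes p: "norm (fst p) < 1"
  shows "christoffel hyp_line_metric p u v = ((2 / (1 - fst p \<bullet> fst p)) *\<^sub>R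
    ((fst u \<bullet> fst p) *\<^sub>R fst v + (fst v \<bullet> fst p) *\<^sub>R fst u - (fst u \<bullet> fst v) *\<^sub>R fst p), 0)"
proof (rule christoffel_eqI)
  define l where "l = 2 / (1 - fst p \<bullet> fst p)"
  have "fst p \<bullet> fst p < 1" using assms
    by (metis dot_square_norm norm_ge_zero one_power2 power_strict_mono zero_neq_numeral
        bot_nat_0.not_eq_extremum)
  then have pos: "(2 / (1 - fst p \<bullet> fst p))\<^sup>2 > 0" by simp
  have fr: "frechet_derivative (\<lambda>q. hyp_line_metric q v w) (at p) u =
      2 * l ^ 3 * (fst u \<bullet> fst p) * (fst v \<bullet> fst w)" for u v w
    using fun_cong[OF frechet_derivative_at[OF has_derivative_hyp_line_metric[OF p]]]
    unfolding l_def by metis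
  show "hyp_line_metric p (x - y) w = hyp_line_metric p x w - hyp_line_metric p y w" for x y w
    by (simp add: hyp_line_metric_def inner_diff_left algebra_simps)
  show "hyp_line_metric p x x > 0" if "x \<noteq> 0" for x
  proof (cases "fst x = 0")
    case True
    then have "snd x \<noteq> 0" using that by (simp add: prod_eq_iff)
    then show ?thesis using True
      by (simp add: hyp_line_metric_def) (metis not_real_square_gt_zero)
  next
    case False
    then have "(2 / (1 - fst p \<bullet> fst p))\<^sup>2 * (fst x \<bullet> fst x) > 0" using pos by simp
    then show ?thesis by (simp add: hyp_line_metric_def dot_square_norm add_pos_nonneg)
  qed
  show "2 * hyp_line_metric p ((2 / (1 - fst p \<bullet> fst p)) *\<^sub>R
    ((fst u \<bullet> fst p) *\<^sub>R fst v + (fst v \<bullet> fst p) *\<^sub>R fst u - (fst u \<bullet> fst v) *\<^sub>R fst p), 0) w =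
     frechet_derivative (\<lambda>q. hyp_line_metric q v w) (at p) u
    + frechet_derivative (\<lambda>q. hyp_line_metric q u w) (at p) v
    - frechet_derivative (\<lambda>q. hyp_line_metric q u v) (at p) w" for w
    unfolding fr unfolding hyp_line_metric_inner l_def[symmetric]
    by (simp add: inner_diff_left inner_add_left power3_eq_cube power2_eq_square algebra_simps inner_commute)
qed

section \<open>Hypersurfaces of revolution\<close>

lemma annulus_D: assumes "y \<in> annulus T" shows "y \<noteq> 0" "ln (norm y) \<in> {-T<..<T}"
proof -
  show "y \<noteq> 0" using annulus_norm_pos[OF assms] by auto
  then show "ln (norm y) \<in> {-T<..<T}"
    using bij_betw_imp_surj_on[OF bij_betw_log_polar[of T]] imageI[OF assms, of log_polar]
    by (metis SigmaD1 log_polar_def)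
qed

lemma open_annulus: "open (annulus T)"
  unfolding annulus_def by (intro open_Collect_conj open_Collect_less continuous_intros)

lemma annulus_borel: "annulus T \<in> sets borel"
  by (rule borel_open[OF open_annulus])

text \<open>
  A rotational hypersurface at hyperbolic distance \<open>f t > 0\<close> from the axis at height t, for an
  arbitrary twice differentiable f.
\<close>

locale revolution_profile =
  fixes T :: real and f f' f'' :: "real \<Rightarrow> real"
  assumes f_pos: "\<And>t. t \<in> {-T<..<T} \<Longrightarrow> f t > 0"
    and f_deriv: "\<And>t. t \<in> {-T<..<T} \<Longrightarrow> (f has_real_derivative f' t) (at t)"
    and f'_deriv: "\<And>t. t \<in> {-T<..<T} \<Longrightarrow> (f' has_real_derivative f'' t) (at t)"
begin

text \<open>
  \<open>\<rho>\<close> is the Euclidean radius in the ball model, and \<open>q t = e\<^bsup>-t\<^esup> \<rho> t\<close>, so that the chart is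
  \<open>y \<mapsto> (q (ln |y|) y, ln |y|)\<close>. The primed functions are their first and second derivatives; those
  of \<open>\<rho>\<close> are written as polynomials in \<open>\<rho>\<close>, \<open>f'\<close> and \<open>f''\<close> by means of \<open>tanh' = 1 - tanh\<^sup>2\<close>.
\<close>

definition "\<rho> t = tanh (f t / 2)"
definition "\<rho>' t = f' t * (1 - (\<rho> t)\<^sup>2) / 2"
definition "\<rho>'' t = f'' t * (1 - (\<rho> t)\<^sup>2) / 2 - \<rho> t * \<rho>' t * f' t"
definition "q t = exp (- t) * \<rho> t"
definition "q' t = exp (- t) * (\<rho>' t - \<rho> t)"
definition "q'' t = exp (- t) * (\<rho>'' t - 2 * \<rho>' t + \<rho> t)"

lemma \<rho>_deriv: "t \<in> {-T<..<T} \<Longrightarrow> (\<rho> has_real_derivative \<rho>' t) (at t)"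
  unfolding \<rho>_def[abs_def] \<rho>'_def
  by (auto intro!: derivative_eq_intros f_deriv)

lemma \<rho>'_deriv: "t \<in> {-T<..<T} \<Longrightarrow> (\<rho>' has_real_derivative \<rho>'' t) (at t)"
  unfolding \<rho>'_def[abs_def] \<rho>''_def
  by (auto intro!: derivative_eq_intros f'_deriv \<rho>_deriv simp: \<rho>'_def field_simps)

lemma q_deriv: "t \<in> {-T<..<T} \<Longrightarrow> (q has_real_derivative q' t) (at t)"
  unfolding q_def[abs_def] q'_def
  by (auto intro!: derivative_eq_intros \<rho>_deriv simp: algebra_simps)

lemma q'_deriv: "t \<in> {-T<..<T} \<Longrightarrow> (q' has_real_derivative q'' t) (at t)"
  unfolding q'_def[abs_def] q''_def
  by (auto intro!: derivative_eq_intros \<rho>_deriv \<rho>'_deriv simp: algebra_simps)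

lemma \<rho>_range: assumes "t \<in> {-T<..<T}" shows "0 < \<rho> t" "\<rho> t < 1" "(\<rho> t)\<^sup>2 < 1"
proof -
  show *: "0 < \<rho> t" "\<rho> t < 1" using f_pos[OF assms] by (auto simp: \<rho>_def tanh_real_lt_1)
  then show "(\<rho> t)\<^sup>2 < 1" by (simp add: power_less_one_iff)
qed

lemma sinh_cosh_f:
  assumes "t \<in> {-T<..<T}"
  shows "sinh (f t) = 2 * \<rho> t / (1 - (\<rho> t)\<^sup>2)" "cosh (f t) = (1 + (\<rho> t)\<^sup>2) / (1 - (\<rho> t)\<^sup>2)"
proof -
  have c: "cosh (f t / 2) > 0" by simp
  have q: "1 - (y / x)\<^sup>2 = (x\<^sup>2 - y\<^sup>2) / x\<^sup>2" if "x > 0" for x y :: real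
    using that by (simp add: field_simps)
  have r: "1 - (\<rho> t)\<^sup>2 = 1 / (cosh (f t / 2))\<^sup>2" "\<rho> t = sinh (f t / 2) / cosh (f t / 2)"
    using q[OF c, of "sinh (f t / 2)"] by (simp_all only: \<rho>_def tanh_def hyperbolic_pythagoras)
  show "sinh (f t) = 2 * \<rho> t / (1 - (\<rho> t)\<^sup>2)"
    using sinh_double[of "f t / 2"] c r by (simp add: power2_eq_square)
  show "cosh (f t) = (1 + (\<rho> t)\<^sup>2) / (1 - (\<rho> t)\<^sup>2)"
  proof -
    have "(1 + (y / x)\<^sup>2) / (1 / x\<^sup>2) = x\<^sup>2 + y\<^sup>2" if "x > 0" for x y :: real
      using that by (simp add: field_simps)
    from this[OF c, of "sinh (f t / 2)"] show ?thesis
      using cosh_double[of "f t / 2"] unfolding r(1) unfolding r(2) by simp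
  qed
qed

lemma catenoid_chart_eq:
  "y \<noteq> 0 \<Longrightarrow> catenoid_chart f y = (q (ln (norm y)) *\<^sub>R y, ln (norm y))"
  by (simp add: catenoid_chart_def catenoid_map_def log_polar_def q_def \<rho>_def exp_minus
      mult.commute)

text \<open>The differential of the chart at y in direction u.\<close>

definition chart_deriv :: "real^'n \<Rightarrow> real^'n \<Rightarrow> (real^'n) \<times> real" where
  "chart_deriv y u =
     ((q' (ln (norm y)) * ((u \<bullet> y) / (y \<bullet> y))) *\<^sub>R y + q (ln (norm y)) *\<^sub>R u, (u \<bullet> y) / (y \<bullet> y))"

text \<open>
  The second derivative of the chart at y in directions u and v; the local Q is the second
  derivative of \<open>ln |y|\<close>.
\<close>

definition chart_deriv2 :: "real^'n \<Rightarrow> real^'n \<Rightarrow> real^'n \<Rightarrow> (real^'n) \<times> real" where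
  "chart_deriv2 y u v =
     (let Q = (u \<bullet> v) / (y \<bullet> y) - 2 * ((u \<bullet> y) * (v \<bullet> y)) / (y \<bullet> y)\<^sup>2; t = ln (norm y) in
     ((q'' t * ((u \<bullet> y) * (v \<bullet> y)) / (y \<bullet> y)\<^sup>2 + q' t * Q) *\<^sub>R y
       + (q' t * (v \<bullet> y) / (y \<bullet> y)) *\<^sub>R u + (q' t * (u \<bullet> y) / (y \<bullet> y)) *\<^sub>R v, Q))"

lemma has_derivative_chart:
  assumes "y \<in> annulus T"
  shows "(catenoid_chart f has_derivative chart_deriv y) (at y)"
proof -
  note y = annulus_D[OF assms]
  have "((\<lambda>y. (q (ln (norm y)) *\<^sub>R y, ln (norm y))) has_derivative chart_deriv y) (at y)"
    unfolding chart_deriv_def[abs_def]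
    by (rule derivative_eq_intros has_derivative_ln_norm has_derivative_of_ln_norm[where \<psi> = q]
        q_deriv y refl)+ (simp add: fun_eq_iff algebra_simps)
  then show ?thesis
    by (rule has_derivative_transform_within_open[of _ _ _ _ "- {0}"])
      (use y in \<open>auto simp: catenoid_chart_eq\<close>)
qed

lemma has_derivative_chart_deriv:
  assumes "y \<in> annulus T"
  shows "((\<lambda>z. chart_deriv z v) has_derivative (\<lambda>u. chart_deriv2 y u v)) (at y)"
proof -
  note y = annulus_D[OF assms]
  show ?thesis
    unfolding chart_deriv_def[abs_def] chart_deriv2_def Let_def
    by (rule derivative_eq_intros has_derivative_of_ln_norm[where \<psi> = q] has_derivative_of_ln_norm[where \<psi> = q']
        q_deriv q'_deriv y has_derivative_inner_ratio refl)+
      (simp add: fun_eq_iff algebra_simps power2_eq_square)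
qed

lemma frechet_derivative_chart:
  "y \<in> annulus T \<Longrightarrow> frechet_derivative (catenoid_chart f) (at y) = chart_deriv y"
  by (rule frechet_derivative_at[OF has_derivative_chart, symmetric])

lemma frechet_derivative_chart2:
  assumes "y \<in> annulus T"
  shows "frechet_derivative (\<lambda>z. frechet_derivative (catenoid_chart f) (at z) v) (at y) u =
    chart_deriv2 y u v"
proof -
  have "frechet_derivative (\<lambda>z. frechet_derivative (catenoid_chart f) (at z) v) (at y) =
    frechet_derivative (\<lambda>z. chart_deriv z v) (at y)"
    by (intro frechet_derivative_cong_open[OF open_annulus assms]) (simp add: frechet_derivative_chart)
  then show ?thesis using frechet_derivative_at[OF has_derivative_chart_deriv[OF assms]] by metis
qed

lemma chart_position:
  assumes "y \<in> annulus T"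
  defines "t \<equiv> ln (norm y)"
  shows "fst (catenoid_chart f y) \<bullet> fst (catenoid_chart f y) = (\<rho> t)\<^sup>2"
    and "norm (fst (catenoid_chart f y)) < 1"
proof -
  note y = annulus_D[OF assms(1)]
  have "norm (fst (catenoid_chart f y)) = \<rho> t"
    using y \<rho>_range[OF y(2)] by (simp add: catenoid_chart_eq q_def t_def exp_minus)
  then show "fst (catenoid_chart f y) \<bullet> fst (catenoid_chart f y) = (\<rho> t)\<^sup>2"
    "norm (fst (catenoid_chart f y)) < 1"
    using \<rho>_range[OF y(2)] by (simp_all add: dot_square_norm t_def)
qed

text \<open>
  With \<open>l\<close> the square root of the conformal factor of the ball model, these identities translate the
  Euclidean chart functions into hyperbolic quantities of f.
\<close>

lemma conformal_identities:
  assumes "y \<in> annulus T"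
  defines "t \<equiv> ln (norm y)"
  defines "l \<equiv> 2 / (1 - (\<rho> t)\<^sup>2)"
  shows "l * q t * norm y = sinh (f t)" "l * (q t + q' t) * norm y = f' t"
    "l * (q t + 2 * q' t + q'' t) * norm y + l\<^sup>2 * q t * (norm y * (q t + q' t))\<^sup>2 * norm y = f'' t"
    "1 + l * (q t)\<^sup>2 * (y \<bullet> y) = cosh (f t)" "l > 0" "q t > 0"
proof -
  note y = annulus_D[OF assms(1)]
  note r = \<rho>_range[OF y(2), folded t_def]
  have [simp]: "exp (- t) = inverse (norm y)" using y by (simp add: t_def exp_minus)
  have ny: "norm y > 0" using y by simp
  have e: "q t * norm y = \<rho> t" "(q t + q' t) * norm y = \<rho>' t"
    "(q t + 2 * q' t + q'' t) * norm y = \<rho>'' t"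
    using ny by (simp_all add: q_def q'_def q''_def field_simps)
  have nz: "1 - (\<rho> t)\<^sup>2 \<noteq> 0" using r by simp
  show "l > 0" using r by (simp add: l_def)
  show "q t > 0" using r ny by (simp add: q_def)
  show "l * q t * norm y = sinh (f t)"
    using sinh_cosh_f(1)[of t] y e(1) by (simp add: l_def t_def mult.assoc)
  show "l * (q t + q' t) * norm y = f' t"
    unfolding mult.assoc e using nz by (simp add: l_def \<rho>'_def)
  have lr: "l * \<rho>' t = f' t" using nz by (simp add: l_def \<rho>'_def)
  have "l * \<rho>'' t = f'' t - l * \<rho> t * \<rho>' t * f' t"
  proof -
    have "l * (f'' t * (1 - (\<rho> t)\<^sup>2) / 2) = f'' t" using nz by (simp add: l_def)
    then show ?thesis by (simp add: \<rho>''_def right_diff_distrib mult_ac)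
  qed
  also have "l * \<rho> t * \<rho>' t * f' t = l\<^sup>2 * \<rho> t * (\<rho>' t)\<^sup>2"
    unfolding lr[symmetric] by (simp add: power2_eq_square)
  finally have "l * \<rho>'' t + l\<^sup>2 * \<rho> t * (\<rho>' t)\<^sup>2 = f'' t" by simp
  then show "l * (q t + 2 * q' t + q'' t) * norm y + l\<^sup>2 * q t * (norm y * (q t + q' t))\<^sup>2 * norm y = f'' t"
    unfolding e[symmetric] by (simp add: mult_ac)
  have "(q t)\<^sup>2 * (y \<bullet> y) = (\<rho> t)\<^sup>2"
    unfolding e[symmetric] by (simp add: power_mult_distrib dot_square_norm)
  then show "1 + l * (q t)\<^sup>2 * (y \<bullet> y) = cosh (f t)"
    using sinh_cosh_f(2)[of t] y nz by (simp add: l_def t_def mult.assoc field_simps)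
qed

text \<open>This is the metric \<open>(1 + f'\<^sup>2) dt\<^sup>2 + sinh\<^sup>2 f d\<xi>\<^sup>2\<close> in the coordinates \<open>y = e\<^sup>t \<xi>\<close>.\<close>

lemma pullback_metric_chart:
  fixes y :: "real^'n"
  assumes "y \<in> annulus T"
  defines "t \<equiv> ln (norm y)"
  shows "pullback_metric hyp_line_metric (catenoid_chart f) y =
    radial_form ((sinh (f t))\<^sup>2 / (y \<bullet> y)) ((1 + (f' t)\<^sup>2 - (sinh (f t))\<^sup>2) / (y \<bullet> y)\<^sup>2) y"
proof (intro ext)
  fix u v :: "real^'n"
  note y = annulus_D[OF assms(1)]
  define l where "l = 2 / (1 - (\<rho> t)\<^sup>2)"
  define s where "s = y \<bullet> y"
  have s: "s > 0" "norm y ^ 2 = s" using y by (auto simp: s_def dot_square_norm)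
  note id = conformal_identities[OF assms(1), folded t_def, folded l_def]
  have 1: "l\<^sup>2 * (q t)\<^sup>2 = (sinh (f t))\<^sup>2 / s"
    unfolding id(1)[symmetric] using s by (simp add: power_mult_distrib)
  have 2: "l\<^sup>2 * (q t + q' t)\<^sup>2 = (f' t)\<^sup>2 / s"
    unfolding id(2)[symmetric] using s by (simp add: power_mult_distrib)
  have "fst (chart_deriv y u) \<bullet> fst (chart_deriv y v) =
     (q t)\<^sup>2 * (u \<bullet> v) + ((q t + q' t)\<^sup>2 - (q t)\<^sup>2) * ((u \<bullet> y) * (v \<bullet> y)) / s"
    unfolding chart_deriv_def t_def[symmetric] s_def[symmetric]
    using s by (simp add: inner_add_left inner_add_right s_def[symmetric] inner_commute power2_eq_square field_simps)
  then have "pullback_metric hyp_line_metric (catenoid_chart f) y u v =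
     l\<^sup>2 * ((q t)\<^sup>2 * (u \<bullet> v) + ((q t + q' t)\<^sup>2 - (q t)\<^sup>2) * ((u \<bullet> y) * (v \<bullet> y)) / s)
      + (u \<bullet> y) / s * ((v \<bullet> y) / s)"
    unfolding pullback_metric_def hyp_line_metric_inner frechet_derivative_chart[OF assms(1)]
      chart_position[OF assms(1), folded t_def] l_def[symmetric]
    by (simp add: chart_deriv_def s_def)
  also have "\<dots> = l\<^sup>2 * (q t)\<^sup>2 * (u \<bullet> v) + (l\<^sup>2 * (q t + q' t)\<^sup>2 - l\<^sup>2 * (q t)\<^sup>2) * ((u \<bullet> y) * (v \<bullet> y)) / s
      + (u \<bullet> y) / s * ((v \<bullet> y) / s)"
    by (simp add: algebra_simps add_divide_distrib diff_divide_distrib)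
  also have "\<dots> = radial_form ((sinh (f t))\<^sup>2 / s) ((1 + (f' t)\<^sup>2 - (sinh (f t))\<^sup>2) / s\<^sup>2) y u v"
    unfolding 1 2 radial_form_def
    using s by (simp add: field_simps power2_eq_square)
  finally show "pullback_metric hyp_line_metric (catenoid_chart f) y u v =
    radial_form ((sinh (f t))\<^sup>2 / (y \<bullet> y)) ((1 + (f' t)\<^sup>2 - (sinh (f t))\<^sup>2) / (y \<bullet> y)\<^sup>2) y u v"
    by (simp add: s_def)
qed

text \<open>
  Orthogonality to the directions tangent to the sphere makes the horizontal part of a unit normal
  radial; the remaining two conditions determine the normal up to the sign of w.
\<close>

lemma unit_normal_chart:
  fixes y :: "real^'n"
  assumes y: "y \<in> annulus T" and nu: "catenoid_unit_normal T f \<nu>"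
  defines "t \<equiv> ln (norm y)"
  defines "l \<equiv> 2 / (1 - (\<rho> t)\<^sup>2)"
  obtains w where "w\<^sup>2 * (1 + (f' t)\<^sup>2) = 1"
    "fst (\<nu> (catenoid_chart f y)) = (w / (l * norm y)) *\<^sub>R y"
    "snd (\<nu> (catenoid_chart f y)) = - w * f' t"
proof -
  define n where "n = \<nu> (catenoid_chart f y)"
  define s where "s = y \<bullet> y"
  note y' = annulus_D[OF y]
  have s: "s > 0" "norm y * norm y = s" using y' by (auto simp: s_def dot_square_norm power2_eq_square)
  note id = conformal_identities[OF y, folded t_def, folded l_def]
  note pos = chart_position[OF y, folded t_def]
  have metric: "hyp_line_metric (catenoid_chart f y) u v = l\<^sup>2 * (fst u \<bullet> fst v) + snd u * snd v" for u v
    by (simp add: hyp_line_metric_inner pos l_def)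
  have orth: "l\<^sup>2 * (fst (chart_deriv y u) \<bullet> fst n) + snd (chart_deriv y u) * snd n = 0" for u
  proof -
    have "hyp_line_metric (catenoid_chart f y) (frechet_derivative (catenoid_chart f) (at y) u) n = 0"
      using nu y unfolding catenoid_unit_normal_def unit_normal_def n_def by blast
    then show ?thesis unfolding metric frechet_derivative_chart[OF y] .
  qed
  have unit: "l\<^sup>2 * (fst n \<bullet> fst n) + snd n * snd n = 1"
  proof -
    have "hyp_line_metric (catenoid_chart f y) n n = 1"
      using nu y unfolding catenoid_unit_normal_def unit_normal_def n_def by blast
    then show ?thesis unfolding metric .
  qed
  define \<alpha> where "\<alpha> = (fst n \<bullet> y) / s"
  define u where "u = fst n - \<alpha> *\<^sub>R y"
  \<comment> \<open>u is the part of the horizontal normal that is tangent to the sphere; it vanishes\<close>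
  have uy: "u \<bullet> y = 0" using s by (simp add: u_def \<alpha>_def inner_diff_left s_def)
  have "l\<^sup>2 * q t * (u \<bullet> fst n) = 0"
    using orth[of u] by (simp add: chart_deriv_def uy t_def)
  then have "u \<bullet> fst n = 0" using id by simp
  then have "u \<bullet> u = 0" using uy
    by (simp add: u_def inner_diff_right)
  then have n1: "fst n = \<alpha> *\<^sub>R y" by (simp add: u_def)
  define w where "w = l * \<alpha> * norm y"
  have n2: "snd n = - w * f' t"
  proof -
    have "l\<^sup>2 * (q' t + q t) * \<alpha> * s + snd n = 0"
      using orth[of y] s by (simp add: chart_deriv_def t_def[symmetric] n1 s_def[symmetric] algebra_simps inner_add_left)
    then have "snd n = - (l\<^sup>2 * (q t + q' t) * \<alpha> * s)" by (simp add: algebra_simps)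
    also have "\<dots> = - w * f' t"
      unfolding id(2)[symmetric] w_def s(2)[symmetric] by (simp add: power2_eq_square mult_ac)
    finally show ?thesis .
  qed
  have W: "w\<^sup>2 = l\<^sup>2 * (fst n \<bullet> fst n)"
    unfolding n1 w_def by (simp add: power2_eq_square s_def[symmetric] s(2)[symmetric])
  have "w\<^sup>2 * (1 + (f' t)\<^sup>2) = 1"
    using unit unfolding W[symmetric] n2 by algebra
  moreover have "fst n = (w / (l * norm y)) *\<^sub>R y"
    using id(5) y' by (simp add: n1 w_def)
  ultimately show ?thesis using that n2 unfolding n_def by blast
qed

text \<open>
  Of the horizontal parts of the second derivative and of the Christoffel term, only the radial
  components matter, because the horizontal part of the normal is a multiple of y.
\<close>

lemma second_fundamental_form_chart:
  fixes y :: "real^'n"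
  assumes y: "y \<in> annulus T"
  defines "t \<equiv> ln (norm y)"
  defines "l \<equiv> 2 / (1 - (\<rho> t)\<^sup>2)"
  assumes n1: "fst (\<nu> (catenoid_chart f y)) = (w / (l * norm y)) *\<^sub>R y"
    and n2: "snd (\<nu> (catenoid_chart f y)) = - w * f' t"
  shows "second_fundamental_form hyp_line_metric (catenoid_chart f) \<nu> y =
     radial_form (- w * sinh (f t) * cosh (f t) / (y \<bullet> y))
       (w * (f'' t + sinh (f t) * cosh (f t)) / (y \<bullet> y)\<^sup>2) y"
proof (intro ext)
  fix u v :: "real^'n"
  define s where "s = y \<bullet> y"
  define r where "r = norm y"
  note y' = annulus_D[OF y]
  have s: "s > 0" "s = r * r" "r > 0" using y' by (auto simp: s_def r_def dot_square_norm power2_eq_square)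
  note id = conformal_identities[OF y, folded t_def, folded l_def, folded s_def r_def]
  note pos = chart_position[OF y, folded t_def]
  have metric: "hyp_line_metric (catenoid_chart f y) u v = l\<^sup>2 * (fst u \<bullet> fst v) + snd u * snd v" for u v
    by (simp add: hyp_line_metric_inner pos l_def)
  let ?U = "fst (chart_deriv y u)" and ?V = "fst (chart_deriv y v)" and ?Q = "q t + q' t"
  have Uy: "fst (chart_deriv y u) \<bullet> y = ?Q * (u \<bullet> y)" for u
    using s by (simp add: chart_deriv_def t_def[symmetric] s_def[symmetric] inner_add_left algebra_simps)
  have UV: "?U \<bullet> ?V = (q t)\<^sup>2 * (u \<bullet> v) + (?Q\<^sup>2 - (q t)\<^sup>2) * ((u \<bullet> y) * (v \<bullet> y)) / s"
    unfolding chart_deriv_def t_def[symmetric] s_def[symmetric]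
    using s(1) by (simp add: inner_add_left inner_add_right s_def[symmetric] inner_commute power2_eq_square field_simps)
  define a where "a = u \<bullet> y"
  define b where "b = v \<bullet> y"
  define c where "c = u \<bullet> v"
  have D2y: "fst (chart_deriv2 y u v) \<bullet> y = q'' t * a * b / s + q' t * c"
    unfolding chart_deriv2_def Let_def t_def[symmetric] s_def[symmetric]
    using s(1) by (simp add: inner_add_left s_def[symmetric] a_def[symmetric] b_def[symmetric] c_def[symmetric])
      (simp add: field_simps power2_eq_square)
  have D2s: "snd (chart_deriv2 y u v) = c / s - 2 * (a * b) / s\<^sup>2"
    by (simp add: chart_deriv2_def Let_def a_def b_def c_def s_def)
  define C where "C = l *\<^sub>R ((?U \<bullet> (q t *\<^sub>R y)) *\<^sub>R ?V + (?V \<bullet> (q t *\<^sub>R y)) *\<^sub>R ?U - (?U \<bullet> ?V) *\<^sub>R (q t *\<^sub>R y))"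
  have christ: "christoffel hyp_line_metric (catenoid_chart f y) (chart_deriv y u) (chart_deriv y v) = (C, 0)"
    unfolding christoffel_hyp_line_metric[OF pos(2)] pos(1) l_def[symmetric] C_def
    using y' by (simp add: catenoid_chart_eq t_def)
  have Cy: "C \<bullet> y = l * (2 * q t * ?Q\<^sup>2 * a * b - ((q t)\<^sup>2 * c + (?Q\<^sup>2 - (q t)\<^sup>2) * (a * b) / s) * q t * s)"
    unfolding C_def by (simp add: inner_add_left inner_diff_left Uy UV s_def[symmetric] a_def b_def c_def power2_eq_square algebra_simps)
  have "second_fundamental_form hyp_line_metric (catenoid_chart f) \<nu> y u v =
     l\<^sup>2 * (w / (l * r)) * (fst (chart_deriv2 y u v) \<bullet> y + C \<bullet> y) + snd (chart_deriv2 y u v) * (- w * f' t)"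
    unfolding second_fundamental_form_def frechet_derivative_chart2[OF y] frechet_derivative_chart[OF y]
      christ metric n2 n1
    by (simp add: inner_add_left r_def)
  also have "\<dots> = l * w / r * ((q'' t * a * b / s + q' t * c)
      + l * (2 * q t * ?Q\<^sup>2 * a * b - ((q t)\<^sup>2 * c + (?Q\<^sup>2 - (q t)\<^sup>2) * (a * b) / s) * q t * s))
      - (c / s - 2 * (a * b) / s\<^sup>2) * (w * (l * ?Q * r))"
    unfolding D2y D2s Cy id(2) using id(5) by (simp add: power2_eq_square)
  also have "\<dots> = - w * (l * q t * r) * (1 + l * (q t)\<^sup>2 * s) / s * c +
       w * ((l * (q t + 2 * q' t + q'' t) * r + l\<^sup>2 * q t * (r * ?Q)\<^sup>2 * r)
         + (l * q t * r) * (1 + l * (q t)\<^sup>2 * s)) / s\<^sup>2 * (a * b)"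
    unfolding s(2) using s(3) by (simp add: field_simps power2_eq_square)
  also have "\<dots> = radial_form (- w * sinh (f t) * cosh (f t) / (y \<bullet> y))
       (w * (f'' t + sinh (f t) * cosh (f t)) / (y \<bullet> y)\<^sup>2) y u v"
    unfolding id(1,3,4) by (simp add: radial_form_def a_def b_def c_def s_def)
  finally show "second_fundamental_form hyp_line_metric (catenoid_chart f) \<nu> y u v = 
     radial_form (- w * sinh (f t) * cosh (f t) / (y \<bullet> y))
       (w * (f'' t + sinh (f t) * cosh (f t)) / (y \<bullet> y)\<^sup>2) y u v" .
qed

text \<open>
  The principal curvatures are \<open>w coth f\<close> up to sign, with multiplicity \<open>n - 1\<close>, and
  \<open>w f'' / (1 + f'\<^sup>2)\<close>, where \<open>w\<^sup>2 = 1 / (1 + f'\<^sup>2)\<close>. In particular the norm does not depend on the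
  choice of the sign of the normal at each point.
\<close>

lemma sff_norm_chart:
  fixes y :: "real^'n"
  assumes y: "y \<in> annulus T" and nu: "catenoid_unit_normal T f \<nu>"
    and inj: "inj_on (catenoid_chart f) (annulus T :: (real^'n) set)"
  defines "t \<equiv> ln (norm y)"
  shows "catenoid_sff_norm T f \<nu> (catenoid_chart f y) =
    sqrt (((real CARD('n) - 1) * (cosh (f t) / sinh (f t))\<^sup>2 + (f'' t / (1 + (f' t)\<^sup>2))\<^sup>2) / (1 + (f' t)\<^sup>2))"
proof -
  define l where "l = 2 / (1 - (\<rho> t)\<^sup>2)"
  define s where "s = y \<bullet> y"
  define S where "S = sinh (f t)"
  define P where "P = 1 + (f' t)\<^sup>2"
  note y' = annulus_D[OF y]
  have s: "s > 0" using y' by (auto simp: s_def)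
  have S: "S > 0" using f_pos y' by (simp add: S_def t_def)
  have P: "P > 0" by (simp add: P_def add_pos_nonneg)
  obtain w where w: "w\<^sup>2 * (1 + (f' t)\<^sup>2) = 1"
    "fst (\<nu> (catenoid_chart f y)) = (w / (l * norm y)) *\<^sub>R y"
    "snd (\<nu> (catenoid_chart f y)) = - w * f' t"
    using unit_normal_chart[OF y nu, folded t_def, folded l_def] by blast
  have w2: "w\<^sup>2 = 1 / P" using w(1) P by (simp add: P_def field_simps)
  define E where "E = S\<^sup>2 / s"
  define F where "F = (P - S\<^sup>2) / s\<^sup>2"
  define A where "A = - w * S * cosh (f t) / s"
  define B where "B = w * (f'' t + S * cosh (f t)) / s\<^sup>2"
  have Fs: "F * s = (P - S\<^sup>2) / s" and Bs: "B * s = w * (f'' t + S * cosh (f t)) / s"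
    using s by (simp_all add: F_def B_def power2_eq_square)
  have EF: "E + F * s = P / s" using s by (simp add: Fs E_def add_divide_distrib[symmetric])
  have nz: "E \<noteq> 0" "E + F * (y \<bullet> y) \<noteq> 0"
    using s S P EF by (simp_all add: E_def s_def)
  have AB: "A + B * s = w * f'' t / s"
    unfolding Bs A_def by (simp add: add_divide_distrib[symmetric] algebra_simps)
  have "catenoid_sff_norm T f \<nu> (catenoid_chart f y) =
    sqrt ((real CARD('n) - 1) * (A / E)\<^sup>2 + ((A + B * s) / (E + F * s))\<^sup>2)"
    unfolding catenoid_sff_norm_def sff_norm_def Let_def the_inv_into_f_f[OF inj y]
      pullback_metric_chart[OF y] second_fundamental_form_chart[where \<nu> = \<nu> and w = w, OF y w(2,3)[unfolded l_def t_def]]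
      t_def[symmetric] s_def[symmetric] S_def[symmetric] P_def[symmetric]
      E_def[symmetric] F_def[symmetric] A_def[symmetric] B_def[symmetric]
    unfolding trace_square_relative_radial_form[OF nz] s_def ..
  also have "A / E = - w * (cosh (f t) / S)"
    using s S by (simp add: A_def E_def power2_eq_square)
  also have "(A + B * s) / (E + F * s) = w * (f'' t / P)"
    unfolding AB EF using s by simp
  also have "(real CARD('n) - 1) * (- w * (cosh (f t) / S))\<^sup>2 + (w * (f'' t / P))\<^sup>2 =
     ((real CARD('n) - 1) * (cosh (f t) / S)\<^sup>2 + (f'' t / P)\<^sup>2) / P"
    unfolding power_mult_distrib power2_minus w2 by (simp add: add_divide_distrib)
  finally show ?thesis by (simp add: S_def P_def)
qed

lemma sqrt_det_gram_chart:
  fixes y :: "real^'n"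
  assumes y: "y \<in> annulus T"
  defines "t \<equiv> ln (norm y)"
  shows "sqrt (det (gram_matrix (pullback_metric hyp_line_metric (catenoid_chart f) y))) =
    sinh (f t) ^ (CARD('n) - 1) * sqrt (1 + (f' t)\<^sup>2) / norm y ^ CARD('n)"
proof -
  define s where "s = y \<bullet> y"
  define S where "S = sinh (f t)"
  define P where "P = 1 + (f' t)\<^sup>2"
  note y' = annulus_D[OF y]
  have s: "s > 0" "s = (norm y)\<^sup>2" using y' by (auto simp: s_def dot_square_norm)
  have S: "S > 0" using f_pos y' by (simp add: S_def t_def)
  have P: "P > 0" by (simp add: P_def add_pos_nonneg)
  have n: "CARD('n) = Suc (CARD('n) - 1)" by simp
  have "S\<^sup>2 / s + (P - S\<^sup>2) / s\<^sup>2 * s = P / s"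
    using s(1) by (simp add: power2_eq_square add_divide_distrib[symmetric])
  then have "det (gram_matrix (pullback_metric hyp_line_metric (catenoid_chart f) y)) =
     (S\<^sup>2 / s) ^ (CARD('n) - 1) * (P / s)"
    unfolding pullback_metric_chart[OF y] det_gram_radial_form
      t_def[symmetric] s_def[symmetric] S_def[symmetric] P_def[symmetric] by simp
  also have "\<dots> = (S ^ (CARD('n) - 1))\<^sup>2 * P / (norm y ^ CARD('n))\<^sup>2"
  proof -
    have "(S\<^sup>2 / r\<^sup>2) ^ m * (P / r\<^sup>2) = (S ^ m)\<^sup>2 * P / (r ^ Suc m)\<^sup>2" for m and r :: real
      by (simp add: power_divide power_mult_distrib power2_eq_square)
    from this[of "norm y" "CARD('n) - 1"] n show ?thesis unfolding s(2) by metis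
  qed
  finally show ?thesis using S y'
    by (simp add: real_sqrt_mult real_sqrt_divide S_def P_def)
qed

end

section \<open>Gauss curvature of surfaces of revolution\<close>

text \<open>
  The polynomial identity behind the curvature computation. The parameters are the inner products
  a, b of the base point with an orthonormal frame u, v, the inverse square norm \<open>\<sigma>\<close> of the base point,
  the coefficients c1, c2, c3 of the Christoffel symbols with their derivatives d1, d2, d3 in the logarithm of the norm,
  and the components of the vectors X = \<open>\<Gamma>(v,v)\<close>, Y = \<open>\<Gamma>(u,v)\<close> and R = \<open>R(u,v)v\<close>.
\<close>

lemma gauss_algebra:
  fixes a b \<sigma> \<kappa> m m' :: real
  assumes "(a\<^sup>2 + b\<^sup>2) * \<sigma> = 1"
  defines "c1 \<equiv> (m - 1) * \<sigma>" and "d1 \<equiv> (m' - 2 * (m - 1)) * \<sigma>"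
    and "c2 \<equiv> (1 - \<kappa> * m) * \<sigma>" and "d2 \<equiv> (- \<kappa> * m' - 2 * (1 - \<kappa> * m)) * \<sigma>"
    and "c3 \<equiv> (1 - \<kappa>) * m * \<sigma>\<^sup>2" and "d3 \<equiv> (1 - \<kappa>) * (m' - 4 * m) * \<sigma>\<^sup>2"
  assumes Xu: "Xu = (c2 - c3 * b\<^sup>2) * a" and Xv: "Xv = 2 * c1 * b + (c2 - c3 * b\<^sup>2) * b"
    and Xy: "Xy = a * Xu + b * Xv"
    and Yu: "Yu = c1 * b - c3 * a * b * a" and Yv: "Yv = c1 * a - c3 * a * b * b"
    and Yy: "Yy = a * Yu + b * Yv"
    and Ru: "Ru = (d2 * (a * \<sigma>) * a + c2 - d3 * (a * \<sigma>) * b\<^sup>2 * a - c3 * b\<^sup>2)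
       - (d1 * (b * \<sigma>) * b + c1 - d3 * (b * \<sigma>) * a * b * a - c3 * a * a)
       + (c1 * (a * Xu + Xy) + c2 * Xu * a - c3 * a * Xy * a)
       - (c1 * (b * Yu) + c2 * Yv * a - c3 * b * Yy * a)"
    and Rv: "Rv = (2 * d1 * (a * \<sigma>) * b + d2 * (a * \<sigma>) * b - d3 * (a * \<sigma>) * b\<^sup>2 * b)
       - (d1 * (b * \<sigma>) * a - d3 * (b * \<sigma>) * a * b * b - c3 * a * b - c3 * a * b)
       + (c1 * (a * Xv) + c2 * Xu * b - c3 * a * Xy * b)
       - (c1 * (b * Yv + Yy) + c2 * Yv * b - c3 * b * Yy * b)"
  shows "\<kappa> * Ru + (1 - \<kappa>) * \<sigma> * a * (a * Ru + b * Rv) = - \<kappa> * m' * \<sigma>"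
  using assms(1) unfolding Ru Rv Xy Yy Xu Xv Yu Yv c1_def c2_def c3_def d1_def d2_def d3_def
  by algebra

text \<open>The Koszul formula for the Christoffel symbols below, as an identity between polynomials.\<close>

lemma koszul_algebra:
  fixes s \<sigma> k \<kappa> :: real
  assumes "s * \<sigma> = 1" "\<kappa> * k = 1 - \<kappa>"
  shows "2 * (\<sigma> * Q * (\<sigma> * (\<mu> - 1) * (a * vw + b * uw) + (\<sigma> * (1 - \<kappa> * \<mu>) * uv - (1 - \<kappa>) * \<sigma>\<^sup>2 * \<mu> * (a * b)) * c)
     + k * \<sigma>\<^sup>2 * Q * ((\<sigma> * (\<mu> - 1) * (a * b + b * a) + (\<sigma> * (1 - \<kappa> * \<mu>) * uv - (1 - \<kappa>) * \<sigma>\<^sup>2 * \<mu> * (a * b)) * s) * c)) =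
    (\<sigma> * (2 * (\<mu> - 1) * Q) * (a * \<sigma>) * vw + k * \<sigma>\<^sup>2 * ((2 * \<mu> - 4) * Q) * (a * \<sigma>) * (b * c) + k * \<sigma>\<^sup>2 * Q * (uv * c + b * uw))
  + (\<sigma> * (2 * (\<mu> - 1) * Q) * (b * \<sigma>) * uw + k * \<sigma>\<^sup>2 * ((2 * \<mu> - 4) * Q) * (b * \<sigma>) * (a * c) + k * \<sigma>\<^sup>2 * Q * (uv * c + a * vw))
  - (\<sigma> * (2 * (\<mu> - 1) * Q) * (c * \<sigma>) * uv + k * \<sigma>\<^sup>2 * ((2 * \<mu> - 4) * Q) * (c * \<sigma>) * (a * b) + k * \<sigma>\<^sup>2 * Q * (uw * b + a * vw))"
  using assms by algebra

text \<open>
  Profiles satisfying \<open>\<kappa> (1 + f'\<^sup>2) = sinh\<^sup>2 f\<close>, the first integral of the catenoid equation for \<open>n = 2\<close>,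
  where \<open>\<kappa> = sinh\<^sup>2 a\<close>. The induced metric is then \<open>sinh\<^sup>2 f (\<kappa>\<^bsup>-1\<^esup> dt\<^sup>2 + d\<xi>\<^sup>2)\<close>, which for \<open>n = 2\<close> is
  conformally flat with factor \<open>sinh\<^sup>2 f\<close>, and its Gauss curvature is \<open>- \<kappa> (ln sinh f)'' / sinh\<^sup>2 f\<close>.
\<close>

locale first_integral_profile = revolution_profile +
  fixes \<kappa> :: real
  assumes \<kappa>_pos: "\<kappa> > 0"
    and first_integral: "\<And>t. t \<in> {-T<..<T} \<Longrightarrow> \<kappa> * (1 + (f' t)\<^sup>2) = (sinh (f t))\<^sup>2"
begin

text \<open>m is the logarithmic derivative of \<open>sinh f\<close>, and \<open>m'\<close> is the derivative of m.\<close>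

definition "m t = cosh (f t) / sinh (f t) * f' t"
definition "m' t = cosh (f t) / sinh (f t) * f'' t - (f' t)\<^sup>2 / (sinh (f t))\<^sup>2"

text \<open>
  The coefficients e1, e2 of the induced metric and c1, c2, c3 of its Christoffel symbols
  \<open>\<Gamma>\<^sub>y(u,v) = c1 ((u \<bullet> y) v + (v \<bullet> y) u) + c2 (u \<bullet> v) y - c3 (u \<bullet> y)(v \<bullet> y) y\<close>, as functions of
  \<open>t = ln |y|\<close>, with their derivatives in t. The factor \<open>e\<^bsup>-2t\<^esup>\<close> is \<open>1 / |y|\<^sup>2\<close>.
\<close>

definition "e1 t = exp (- 2 * t) * (sinh (f t))\<^sup>2"
definition "e1' t = exp (- 2 * t) * (2 * (m t - 1) * (sinh (f t))\<^sup>2)"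
definition "e2 t = (1 / \<kappa> - 1) * exp (- 4 * t) * (sinh (f t))\<^sup>2"
definition "e2' t = (1 / \<kappa> - 1) * exp (- 4 * t) * ((2 * m t - 4) * (sinh (f t))\<^sup>2)"
definition "c1 t = exp (- 2 * t) * (m t - 1)"
definition "c1' t = exp (- 2 * t) * (m' t - 2 * (m t - 1))"
definition "c2 t = exp (- 2 * t) * (1 - \<kappa> * m t)"
definition "c2' t = exp (- 2 * t) * (- \<kappa> * m' t - 2 * (1 - \<kappa> * m t))"
definition "c3 t = (1 - \<kappa>) * exp (- 4 * t) * m t"
definition "c3' t = (1 - \<kappa>) * exp (- 4 * t) * (m' t - 4 * m t)"

lemma sinh_f_pos: "t \<in> {-T<..<T} \<Longrightarrow> sinh (f t) > 0"
  using f_pos by simp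

lemma m_deriv: assumes t: "t \<in> {-T<..<T}" shows "(m has_real_derivative m' t) (at t)"
proof -
  have s: "sinh (f t) \<noteq> 0" using sinh_f_pos[OF t] by simp
  have "((\<lambda>t. cosh (f t) / sinh (f t)) has_real_derivative - f' t / (sinh (f t))\<^sup>2) (at t)"
  proof -
    have "((\<lambda>t. cosh (f t) / sinh (f t)) has_real_derivative
       ((sinh (f t) * f' t) * sinh (f t) - cosh (f t) * (cosh (f t) * f' t)) / (sinh (f t) * sinh (f t))) (at t)"
      using s by (intro DERIV_divide) (auto intro!: derivative_eq_intros f_deriv t)
    also have "(sinh (f t) * f' t) * sinh (f t) - cosh (f t) * (cosh (f t) * f' t) = - f' t"
      using hyperbolic_pythagoras[of "f t"] by algebra
    finally show ?thesis by (simp add: power2_eq_square)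
  qed
  from DERIV_mult[OF this f'_deriv[OF t]] show ?thesis
    unfolding m_def[abs_def] m'_def by (simp add: power2_eq_square mult_ac)
qed

lemma e1_deriv: assumes t: "t \<in> {-T<..<T}" shows "(e1 has_real_derivative e1' t) (at t)"
  unfolding e1_def[abs_def] e1'_def m_def using sinh_f_pos[OF t]
  by (auto intro!: derivative_eq_intros f_deriv t simp: power2_eq_square algebra_simps)

lemma e2_deriv: assumes t: "t \<in> {-T<..<T}" shows "(e2 has_real_derivative e2' t) (at t)"
  unfolding e2_def[abs_def] e2'_def m_def using sinh_f_pos[OF t] \<kappa>_pos
  by (auto intro!: derivative_eq_intros f_deriv t simp: power2_eq_square field_simps)

lemma c1_deriv: assumes t: "t \<in> {-T<..<T}" shows "(c1 has_real_derivative c1' t) (at t)"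
  unfolding c1_def[abs_def] c1'_def
  by (auto intro!: derivative_eq_intros m_deriv t simp: algebra_simps)

lemma c2_deriv: assumes t: "t \<in> {-T<..<T}" shows "(c2 has_real_derivative c2' t) (at t)"
  unfolding c2_def[abs_def] c2'_def
  by (auto intro!: derivative_eq_intros m_deriv t simp: algebra_simps)

lemma c3_deriv: assumes t: "t \<in> {-T<..<T}" shows "(c3 has_real_derivative c3' t) (at t)"
  unfolding c3_def[abs_def] c3'_def
  by (auto intro!: derivative_eq_intros m_deriv t simp: algebra_simps)

lemma pullback_metric_chart_conformal:
  fixes y :: "real^'n"
  assumes "y \<in> annulus T"
  shows "pullback_metric hyp_line_metric (catenoid_chart f) y =
    radial_form (e1 (ln (norm y))) (e2 (ln (norm y))) y"
proof -
  note y = annulus_D[OF assms]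
  have "1 + (f' (ln (norm y)))\<^sup>2 = (sinh (f (ln (norm y))))\<^sup>2 / \<kappa>"
    using first_integral[OF y(2)] \<kappa>_pos by (simp add: field_simps)
  then show ?thesis
    unfolding pullback_metric_chart[OF assms] e1_def e2_def exp_ln_norm[OF y(1)]
    by (simp add: power_divide left_diff_distrib)
qed

lemma frechet_derivative_pullback_metric_chart:
  fixes y :: "real^'n"
  assumes "y \<in> annulus T"
  defines "t \<equiv> ln (norm y)"
  shows "frechet_derivative (\<lambda>z. pullback_metric hyp_line_metric (catenoid_chart f) z u v) (at y) w =
    e1' t * ((w \<bullet> y) / (y \<bullet> y)) * (u \<bullet> v) + e2' t * ((w \<bullet> y) / (y \<bullet> y)) * ((u \<bullet> y) * (v \<bullet> y))
      + e2 t * ((u \<bullet> w) * (v \<bullet> y) + (u \<bullet> y) * (v \<bullet> w))"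
proof -
  note y = annulus_D[OF assms(1)]
  have fr: "frechet_derivative (\<lambda>z. pullback_metric hyp_line_metric (catenoid_chart f) z u v) (at y) =
    frechet_derivative (\<lambda>z. radial_form (e1 (ln (norm z))) (e2 (ln (norm z))) z u v) (at y)"
    by (intro frechet_derivative_cong_open[OF open_annulus assms(1)])
      (simp add: pullback_metric_chart_conformal)
  have D: "((\<lambda>z. radial_form (e1 (ln (norm z))) (e2 (ln (norm z))) z u v) has_derivative
    (\<lambda>w. e1' t * ((w \<bullet> y) / (y \<bullet> y)) * (u \<bullet> v) + e2' t * ((w \<bullet> y) / (y \<bullet> y)) * ((u \<bullet> y) * (v \<bullet> y))
      + e2 t * ((u \<bullet> w) * (v \<bullet> y) + (u \<bullet> y) * (v \<bullet> w)))) (at y)"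
  proof -
    note D = has_derivative_of_ln_norm[OF y(1)]
    have I: "((\<lambda>z. x \<bullet> z) has_derivative (\<lambda>w. x \<bullet> w)) (at y)" for x
      by (intro has_derivative_inner_right has_derivative_ident)
    show ?thesis unfolding radial_form_def t_def
      by (rule has_derivative_eq_rhs, rule has_derivative_add[OF has_derivative_mult_left[OF D[OF e1_deriv[OF y(2)]]]
          has_derivative_mult[OF D[OF e2_deriv[OF y(2)]] has_derivative_mult[OF I[of u] I[of v]]]])
        (simp add: fun_eq_iff algebra_simps)
  qed
  show ?thesis unfolding fr frechet_derivative_at[OF D, symmetric] ..
qed

text \<open>The Christoffel symbols of the induced metric in the chart.\<close>

definition chart_christoffel :: "real^'n \<Rightarrow> real^'n \<Rightarrow> real^'n \<Rightarrow> real^'n" where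
  "chart_christoffel y u v = c1 (ln (norm y)) *\<^sub>R ((u \<bullet> y) *\<^sub>R v + (v \<bullet> y) *\<^sub>R u)
     + (c2 (ln (norm y)) * (u \<bullet> v) - c3 (ln (norm y)) * ((u \<bullet> y) * (v \<bullet> y))) *\<^sub>R y"

lemma christoffel_chart:
  fixes y :: "real^'n"
  assumes "y \<in> annulus T"
  shows "christoffel (pullback_metric hyp_line_metric (catenoid_chart f)) y u v = chart_christoffel y u v"
proof (rule christoffel_eqI)
  define t where "t = ln (norm y)"
  define s where "s = y \<bullet> y"
  define \<sigma> where "\<sigma> = 1 / s"
  define Q where "Q = (sinh (f t))\<^sup>2"
  define k where "k = 1 / \<kappa> - 1"
  note y = annulus_D[OF assms]
  have s: "s > 0" using y by (simp add: s_def)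
  have k: "\<kappa> * k = 1 - \<kappa>" using \<kappa>_pos by (simp add: k_def field_simps)
  have Q: "Q > 0" using sinh_f_pos[OF y(2)] by (simp add: Q_def t_def)
  note ex = exp_ln_norm[OF y(1), folded t_def s_def, folded \<sigma>_def]
  note P = pullback_metric_chart_conformal[OF assms, folded t_def]
  show "pullback_metric hyp_line_metric (catenoid_chart f) y (x - z) w =
      pullback_metric hyp_line_metric (catenoid_chart f) y x w
      - pullback_metric hyp_line_metric (catenoid_chart f) y z w" for x z w
    by (simp add: P radial_form_def inner_diff_left algebra_simps)
  show "pullback_metric hyp_line_metric (catenoid_chart f) y x x > 0" if "x \<noteq> 0" for x
  proof -
    have "(x \<bullet> y) * (x \<bullet> y) \<le> (x \<bullet> x) * s"
      using Cauchy_Schwarz_ineq[of x y] by (simp add: power2_eq_square s_def)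
    then have cs: "(x \<bullet> y)\<^sup>2 * \<sigma> \<le> x \<bullet> x"
      using s by (simp add: \<sigma>_def field_simps power2_eq_square)
    have "pullback_metric hyp_line_metric (catenoid_chart f) y x x =
      \<sigma> * Q * (x \<bullet> x - (x \<bullet> y)\<^sup>2 * \<sigma> + (x \<bullet> y)\<^sup>2 * \<sigma> / \<kappa>)"
      unfolding P radial_form_def e1_def e2_def ex Q_def by (simp add: power2_eq_square algebra_simps)
    also have "x \<bullet> x - (x \<bullet> y)\<^sup>2 * \<sigma> + (x \<bullet> y)\<^sup>2 * \<sigma> / \<kappa> > 0"
    proof (cases "x \<bullet> y = 0")
      case False
      then have "(x \<bullet> y)\<^sup>2 * \<sigma> / \<kappa> > 0" using \<kappa>_pos s by (simp add: \<sigma>_def)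
      then show ?thesis using cs by linarith
    qed (use that in simp)
    then have "\<sigma> * Q * (x \<bullet> x - (x \<bullet> y)\<^sup>2 * \<sigma> + (x \<bullet> y)\<^sup>2 * \<sigma> / \<kappa>) > 0"
      using Q s by (simp add: \<sigma>_def)
    finally show ?thesis .
  qed
  fix w
  define M where "M = m t"
  have fr: "frechet_derivative (\<lambda>z. pullback_metric hyp_line_metric (catenoid_chart f) z u v) (at y) w =
    \<sigma> * (2 * (M - 1) * Q) * ((w \<bullet> y) * \<sigma>) * (u \<bullet> v) +
    k * \<sigma>\<^sup>2 * ((2 * M - 4) * Q) * ((w \<bullet> y) * \<sigma>) * ((u \<bullet> y) * (v \<bullet> y))
      + k * \<sigma>\<^sup>2 * Q * ((u \<bullet> w) * (v \<bullet> y) + (u \<bullet> y) * (v \<bullet> w))" for u v w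
    unfolding frechet_derivative_pullback_metric_chart[OF assms, folded t_def]
      e1'_def e2'_def e2_def ex M_def Q_def[symmetric] k_def s_def[symmetric]
    by (simp add: \<sigma>_def)
  have L: "pullback_metric hyp_line_metric (catenoid_chart f) y (chart_christoffel y u v) w =
    \<sigma> * Q * (\<sigma> * (M - 1) * ((u \<bullet> y) * (v \<bullet> w) + (v \<bullet> y) * (u \<bullet> w))
        + (\<sigma> * (1 - \<kappa> * M) * (u \<bullet> v) - (1 - \<kappa>) * \<sigma>\<^sup>2 * M * ((u \<bullet> y) * (v \<bullet> y))) * (w \<bullet> y))
     + k * \<sigma>\<^sup>2 * Q * ((\<sigma> * (M - 1) * ((u \<bullet> y) * (v \<bullet> y) + (v \<bullet> y) * (u \<bullet> y))
        + (\<sigma> * (1 - \<kappa> * M) * (u \<bullet> v) - (1 - \<kappa>) * \<sigma>\<^sup>2 * M * ((u \<bullet> y) * (v \<bullet> y))) * s) * (w \<bullet> y))"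
    unfolding P radial_form_def chart_christoffel_def t_def[symmetric]
      e1_def e2_def c1_def c2_def c3_def ex
    by (simp add: inner_add_left M_def Q_def k_def s_def inner_commute[of y w])
  show "2 * pullback_metric hyp_line_metric (catenoid_chart f) y (chart_christoffel y u v) w =
    frechet_derivative (\<lambda>q. pullback_metric hyp_line_metric (catenoid_chart f) q v w) (at y) u
    + frechet_derivative (\<lambda>q. pullback_metric hyp_line_metric (catenoid_chart f) q u w) (at y) v
    - frechet_derivative (\<lambda>q. pullback_metric hyp_line_metric (catenoid_chart f) q u v) (at y) w"
    unfolding fr L
    using koszul_algebra[of s \<sigma> \<kappa> k Q M "u \<bullet> y" "v \<bullet> w" "v \<bullet> y" "u \<bullet> w" "u \<bullet> v" "w \<bullet> y"] k s
    by (simp add: \<sigma>_def inner_commute[of v u] inner_commute[of w])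
qed

lemma frechet_derivative_christoffel_chart:
  fixes y :: "real^'n"
  assumes "y \<in> annulus T"
  defines "t \<equiv> ln (norm y)"
  shows "frechet_derivative (\<lambda>z. christoffel (pullback_metric hyp_line_metric (catenoid_chart f)) z u v) (at y) w =
     (c1' t * ((w \<bullet> y) / (y \<bullet> y))) *\<^sub>R ((u \<bullet> y) *\<^sub>R v + (v \<bullet> y) *\<^sub>R u)
     + c1 t *\<^sub>R ((u \<bullet> w) *\<^sub>R v + (v \<bullet> w) *\<^sub>R u)
     + (c2' t * ((w \<bullet> y) / (y \<bullet> y)) * (u \<bullet> v) - c3' t * ((w \<bullet> y) / (y \<bullet> y)) * ((u \<bullet> y) * (v \<bullet> y))
         - c3 t * ((u \<bullet> w) * (v \<bullet> y) + (u \<bullet> y) * (v \<bullet> w))) *\<^sub>R y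
     + (c2 t * (u \<bullet> v) - c3 t * ((u \<bullet> y) * (v \<bullet> y))) *\<^sub>R w" (is "_ = ?D w")
proof -
  note y = annulus_D[OF assms(1)]
  have fr: "frechet_derivative (\<lambda>z. christoffel (pullback_metric hyp_line_metric (catenoid_chart f)) z u v) (at y) =
    frechet_derivative (\<lambda>z. chart_christoffel z u v) (at y)"
    by (intro frechet_derivative_cong_open[OF open_annulus assms(1)]) (simp add: christoffel_chart)
  have D: "((\<lambda>z. chart_christoffel z u v) has_derivative ?D) (at y)"
  proof -
    note D = has_derivative_of_ln_norm[OF y(1)]
    have I: "((\<lambda>z. x \<bullet> z) has_derivative (\<lambda>w. x \<bullet> w)) (at y)" for x
      by (intro has_derivative_inner_right has_derivative_ident)
    show ?thesis unfolding chart_christoffel_def t_def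
      by (rule has_derivative_eq_rhs, rule has_derivative_add[OF
          has_derivative_scaleR[OF D[OF c1_deriv[OF y(2)]]
            has_derivative_add[OF has_derivative_scaleR_left[OF I[of u]] has_derivative_scaleR_left[OF I[of v]]]]
          has_derivative_scaleR[OF has_derivative_diff[OF has_derivative_mult_left[OF D[OF c2_deriv[OF y(2)]]]
             has_derivative_mult[OF D[OF c3_deriv[OF y(2)]] has_derivative_mult[OF I[of u] I[of v]]]]
           has_derivative_ident]])
        (simp add: fun_eq_iff algebra_simps)
  qed
  show ?thesis unfolding fr frechet_derivative_at[OF D, symmetric] ..
qed

text \<open>
  The sectional curvature of a plane that contains the radial direction. On a surface this is the
  Gauss curvature, in agreement with the formula for conformally flat metrics.
\<close>

lemma sectional_curvature_chart:
  fixes y u v :: "real^'n"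
  assumes y: "y \<in> annulus T"
    and on: "u \<bullet> u = 1" "v \<bullet> v = 1" "u \<bullet> v = 0" and span: "y = (y \<bullet> u) *\<^sub>R u + (y \<bullet> v) *\<^sub>R v"
  defines "t \<equiv> ln (norm y)"
  shows "sectional_curvature (pullback_metric hyp_line_metric (catenoid_chart f)) y u v =
    - \<kappa> * m' t / (sinh (f t))\<^sup>2"
proof -
  define s where "s = y \<bullet> y"
  define \<sigma> where "\<sigma> = 1 / s"
  define Q where "Q = (sinh (f t))\<^sup>2"
  define a where "a = y \<bullet> u"
  define b where "b = y \<bullet> v"
  define G :: "(real^'n) riem_metric" where "G = pullback_metric hyp_line_metric (catenoid_chart f)"
  note y' = annulus_D[OF y]
  have s: "s > 0" using y' by (simp add: s_def)
  have Q: "Q > 0" using sinh_f_pos[OF y'(2)] by (simp add: Q_def t_def)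
  note ex = exp_ln_norm[OF y'(1), folded t_def s_def, folded \<sigma>_def]
  have yab: "z \<bullet> y = a * (z \<bullet> u) + b * (z \<bullet> v)" for z
    using span by (metis a_def b_def inner_add_right inner_scaleR_right)
  have sab: "s = a\<^sup>2 + b\<^sup>2"
    using yab[of y] by (simp add: s_def a_def b_def power2_eq_square)
  have ab\<sigma>: "(a\<^sup>2 + b\<^sup>2) * \<sigma> = 1" unfolding sab[symmetric] using s by (simp add: \<sigma>_def)
  have on': "v \<bullet> u = 0" "u \<bullet> y = a" "v \<bullet> y = b" "y \<bullet> u = a" "y \<bullet> v = b"
    using on by (simp_all add: inner_commute a_def b_def)
  define X where "X = chart_christoffel y v v"
  define Y where "Y = chart_christoffel y u v"
  define R where "R = riemann_curvature G y u v v"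
  have R: "R = (c2' t * (a * \<sigma>) - c3' t * (a * \<sigma>) * (b * b)) *\<^sub>R y + (c1' t * (a * \<sigma>)) *\<^sub>R (b *\<^sub>R v + b *\<^sub>R v)
       + (c2 t - c3 t * (b * b)) *\<^sub>R u
     - ((c1' t * (b * \<sigma>)) *\<^sub>R (a *\<^sub>R v + b *\<^sub>R u) + c1 t *\<^sub>R u
       + (- c3' t * (b * \<sigma>) * (a * b) - c3 t * a) *\<^sub>R y - (c3 t * (a * b)) *\<^sub>R v)
     + chart_christoffel y u X - chart_christoffel y v Y"
    unfolding R_def riemann_curvature_def G_def frechet_derivative_christoffel_chart[OF y, folded t_def]
      christoffel_chart[OF y] X_def[symmetric] Y_def[symmetric]
    by (simp add: on on' s_def[symmetric] \<sigma>_def algebra_simps)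
  have chz: "chart_christoffel y p z \<bullet> x = c1 t * ((p \<bullet> y) * (z \<bullet> x) + (z \<bullet> y) * (p \<bullet> x))
     + (c2 t * (z \<bullet> p) - c3 t * ((p \<bullet> y) * (z \<bullet> y))) * (y \<bullet> x)" for p z x
    unfolding chart_christoffel_def t_def[symmetric] by (simp add: inner_add_left inner_commute[of p z])
  have Rx: "R \<bullet> x = (c2' t * (a * \<sigma>) - c3' t * (a * \<sigma>) * (b * b)) * (y \<bullet> x) + (c1' t * (a * \<sigma>)) * (b * (v \<bullet> x) + b * (v \<bullet> x))
       + (c2 t - c3 t * (b * b)) * (u \<bullet> x)
     - ((c1' t * (b * \<sigma>)) * (a * (v \<bullet> x) + b * (u \<bullet> x)) + c1 t * (u \<bullet> x)
       + (- c3' t * (b * \<sigma>) * (a * b) - c3 t * a) * (y \<bullet> x) - (c3 t * (a * b)) * (v \<bullet> x))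
     + (c1 t * (a * (X \<bullet> x) + (X \<bullet> y) * (u \<bullet> x)) + (c2 t * (X \<bullet> u) - c3 t * (a * (X \<bullet> y))) * (y \<bullet> x))
     - (c1 t * (b * (Y \<bullet> x) + (Y \<bullet> y) * (v \<bullet> x)) + (c2 t * (Y \<bullet> v) - c3 t * (b * (Y \<bullet> y))) * (y \<bullet> x))" for x
    unfolding R by (simp only: inner_add_left inner_diff_left inner_scaleR_left chz on')
  have Rin: "R \<bullet> u = (c2' t * (a * \<sigma>) * a + c2 t - c3' t * (a * \<sigma>) * b\<^sup>2 * a - c3 t * b\<^sup>2)
       - (c1' t * (b * \<sigma>) * b + c1 t - c3' t * (b * \<sigma>) * a * b * a - c3 t * a * a)
       + (c1 t * (a * (X \<bullet> u) + (X \<bullet> y)) + c2 t * (X \<bullet> u) * a - c3 t * a * (X \<bullet> y) * a)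
       - (c1 t * (b * (Y \<bullet> u)) + c2 t * (Y \<bullet> v) * a - c3 t * b * (Y \<bullet> y) * a)"
    "R \<bullet> v = (2 * c1' t * (a * \<sigma>) * b + c2' t * (a * \<sigma>) * b - c3' t * (a * \<sigma>) * b\<^sup>2 * b)
       - (c1' t * (b * \<sigma>) * a - c3' t * (b * \<sigma>) * a * b * b - c3 t * a * b - c3 t * a * b)
       + (c1 t * (a * (X \<bullet> v)) + c2 t * (X \<bullet> u) * b - c3 t * a * (X \<bullet> y) * b)
       - (c1 t * (b * (Y \<bullet> v) + (Y \<bullet> y)) + c2 t * (Y \<bullet> v) * b - c3 t * b * (Y \<bullet> y) * b)"
    unfolding Rx on on' by algebra+
  have X: "X \<bullet> u = (c2 t - c3 t * b\<^sup>2) * a" "X \<bullet> v = 2 * c1 t * b + (c2 t - c3 t * b\<^sup>2) * b"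
    and Y: "Y \<bullet> u = c1 t * b - c3 t * a * b * a" "Y \<bullet> v = c1 t * a - c3 t * a * b * b"
    unfolding X_def Y_def chz by (simp_all add: on on' power2_eq_square algebra_simps)
  have cs: "c1 t = (m t - 1) * \<sigma>" "c1' t = (m' t - 2 * (m t - 1)) * \<sigma>"
    "c2 t = (1 - \<kappa> * m t) * \<sigma>" "c2' t = (- \<kappa> * m' t - 2 * (1 - \<kappa> * m t)) * \<sigma>"
    "c3 t = (1 - \<kappa>) * m t * \<sigma>\<^sup>2" "c3' t = (1 - \<kappa>) * (m' t - 4 * m t) * \<sigma>\<^sup>2"
    unfolding c1_def c1'_def c2_def c2'_def c3_def c3'_def ex by simp_all
  have key: "\<kappa> * (R \<bullet> u) + (1 - \<kappa>) * \<sigma> * a * (a * (R \<bullet> u) + b * (R \<bullet> v)) = - \<kappa> * m' t * \<sigma>"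
    by (rule gauss_algebra[OF ab\<sigma> X[unfolded cs] yab Y[unfolded cs] yab Rin[unfolded cs]])
  have G: "G y p z = Q * \<sigma> / \<kappa> * (\<kappa> * (p \<bullet> z) + (1 - \<kappa>) * \<sigma> * (z \<bullet> y) * (p \<bullet> y))" for p z
    unfolding G_def pullback_metric_chart_conformal[OF y, folded t_def] radial_form_def e1_def e2_def ex Q_def
    using \<kappa>_pos by (simp add: field_simps power2_eq_square)
  have "G y R u = - m' t * Q * \<sigma>\<^sup>2"
    unfolding G on' yab[of R] key using \<kappa>_pos by (simp add: power2_eq_square)
  moreover have "G y u u * G y v v - (G y u v)\<^sup>2 = Q\<^sup>2 * \<sigma>\<^sup>2 / \<kappa>"
  proof -
    define c where "c = Q * \<sigma> / \<kappa>"
    have "c * (\<kappa> * 1 + (1 - \<kappa>) * \<sigma> * a * a) * (c * (\<kappa> * 1 + (1 - \<kappa>) * \<sigma> * b * b))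
        - (c * (\<kappa> * 0 + (1 - \<kappa>) * \<sigma> * b * a))\<^sup>2 = c\<^sup>2 * \<kappa>"
      using ab\<sigma> by algebra
    then have "G y u u * G y v v - (G y u v)\<^sup>2 = (Q * \<sigma> / \<kappa>)\<^sup>2 * \<kappa>"
      unfolding G on on' c_def .
    then show ?thesis using \<kappa>_pos by (simp add: power2_eq_square)
  qed
  ultimately have "sectional_curvature G y u v = - m' t * Q * \<sigma>\<^sup>2 / (Q\<^sup>2 * \<sigma>\<^sup>2 / \<kappa>)"
    by (simp add: sectional_curvature_def R_def)
  also have "\<dots> = - \<kappa> * m' t / Q"
    using Q s by (simp add: \<sigma>_def power2_eq_square)
  finally show ?thesis by (simp add: G_def Q_def)
qed

lemma gauss_curvature_chart:
  fixes y :: "real^'n"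
  assumes card: "CARD('n) = 2" and y: "y \<in> annulus T"
  defines "t \<equiv> ln (norm y)"
  shows "gauss_curvature (pullback_metric hyp_line_metric (catenoid_chart f)) y =
    - \<kappa> * m' t / (sinh (f t))\<^sup>2"
proof -
  obtain p :: "'n \<times> 'n" where p: "p = (SOME (i, j). i \<noteq> j)" by simp
  obtain i j where ij: "p = (i, j)" by (cases p)
  have "\<exists>p :: 'n \<times> 'n. case p of (i, j) \<Rightarrow> i \<noteq> j"
    using card by (auto simp: card_2_iff)
  from someI_ex[OF this] have ne: "i \<noteq> j" by (metis (mono_tags, lifting) case_prod_conv ij p)
  have UNIV: "UNIV = {i, j}"
    using card ne by (intro card_subset_eq[symmetric]) auto
  have "y = (y \<bullet> axis i 1) *\<^sub>R axis i 1 + (y \<bullet> axis j 1) *\<^sub>R axis j 1"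
    unfolding vec_eq_iff
  proof
    fix l
    have "l = i \<or> l = j" using UNIV by auto
    then show "y $ l = ((y \<bullet> axis i 1) *\<^sub>R axis i 1 + (y \<bullet> axis j 1) *\<^sub>R axis j 1) $ l"
      using ne by (simp add: inner_axis) (auto simp: axis_def)
  qed
  then have "sectional_curvature (pullback_metric hyp_line_metric (catenoid_chart f)) y (axis i 1) (axis j 1) =
    - \<kappa> * m' t / (sinh (f t))\<^sup>2"
    unfolding t_def using ne by (intro sectional_curvature_chart y) (auto simp: inner_axis_axis)
  then show ?thesis
    by (simp add: gauss_curvature_def p[symmetric] ij)
qed

end

section \<open>The profile equation of the catenoid\<close>

lemma cosh_over_sinh_antimono:
  fixes x y :: real
  assumes "0 < x" "x \<le> y" shows "cosh y / sinh y \<le> cosh x / sinh x"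
proof -
  have "sinh (y - x) \<ge> 0" using assms by simp
  then have "cosh y * sinh x \<le> cosh x * sinh y" by (simp add: sinh_diff mult.commute)
  then show ?thesis using assms by (simp add: field_simps)
qed

text \<open>
  A solution of the profile equation for catenoids of dimension \<open>k + 1\<close>, with the right-hand side of
  the equation in the role of the second derivative. Maximality is not part of the locale.
\<close>

locale catenoid_profile =
  revolution_profile T f f' "\<lambda>t. real k * (cosh (f t) / sinh (f t)) * (1 + (f' t)\<^sup>2)"
  for k :: nat and T :: real and f f' :: "real \<Rightarrow> real" +
  fixes a :: real
  assumes k_pos: "k \<ge> 1" and a_pos: "a > 0" and T_pos: "T > 0"
    and f_0: "f 0 = a" and f'_0: "f' 0 = 0"
begin

text \<open>
  The quantity \<open>ln (1 + f'\<^sup>2) - 2 k ln (sinh f)\<close> is constant along solutions.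
\<close>

lemma first_integral:
  assumes t: "t \<in> {-T<..<T}"
  shows "1 + (f' t)\<^sup>2 = (sinh (f t) / sinh a) ^ (2 * k)"
proof -
  define H where "H = (\<lambda>t. ln (1 + (f' t)\<^sup>2) - 2 * real k * ln (sinh (f t)))"
  have D: "(H has_real_derivative 0) (at t within {-T<..<T})" if "t \<in> {-T<..<T}" for t
  proof -
    have s: "sinh (f t) > 0" using f_pos[OF that] by simp
    have p: "1 + (f' t)\<^sup>2 > 0" by (simp add: add_pos_nonneg)
    have "(H has_real_derivative
        (2 * f' t * (real k * (cosh (f t) / sinh (f t)) * (1 + (f' t)\<^sup>2))) / (1 + (f' t)\<^sup>2)
        - 2 * real k * (cosh (f t) * f' t / sinh (f t))) (at t)"
      unfolding H_def using s p f_deriv[OF that] f'_deriv[OF that]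
      by (auto intro!: derivative_eq_intros)
    moreover have "(2 * f' t * (real k * (cosh (f t) / sinh (f t)) * (1 + (f' t)\<^sup>2))) / (1 + (f' t)\<^sup>2)
        - 2 * real k * (cosh (f t) * f' t / sinh (f t)) = 0"
    proof -
      have "2 * f' t * (real k * (cosh (f t) / sinh (f t)) * (1 + (f' t)\<^sup>2)) / (1 + (f' t)\<^sup>2) =
          2 * f' t * (real k * (cosh (f t) / sinh (f t)))"
        using p by simp
      then show ?thesis by simp
    qed
    ultimately show ?thesis
      using DERIV_subset by fastforce
  qed
  have "\<exists>c. \<forall>t\<in>{-T<..<T}. H t = c"
    using D by (intro has_field_derivative_zero_constant) auto
  then have "H t = H 0" using t T_pos by auto
  moreover have s: "sinh (f t) > 0" "sinh a > 0" using f_pos[OF t] a_pos by simp_all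
  moreover have p: "1 + (f' t)\<^sup>2 > 0" by (simp add: add_pos_nonneg)
  ultimately have "ln (1 + (f' t)\<^sup>2) = ln ((sinh (f t) / sinh a) ^ (2 * k))"
    by (simp add: H_def f_0 f'_0 ln_realpow ln_div algebra_simps)
  then show ?thesis
    using s p by (subst (asm) ln_inj_iff) (auto intro!: zero_less_power divide_pos_pos)
qed

lemma f_ge: assumes t: "t \<in> {-T<..<T}" shows "f t \<ge> a"
proof (rule ccontr)
  assume "\<not> f t \<ge> a"
  then have "sinh (f t) < sinh a" by simp
  then have "sinh (f t) / sinh a < 1" "sinh (f t) / sinh a \<ge> 0"
    using f_pos[OF t] a_pos by (auto simp: field_simps)
  then have "(sinh (f t) / sinh a) ^ (2 * k) < 1"
    using k_pos power_Suc_less_one[of "sinh (f t) / sinh a"] power_decreasing[of 1 "2 * k" "sinh (f t) / sinh a"] by auto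
  moreover have "1 + (f' t)\<^sup>2 \<ge> 1" by simp
  ultimately show False using first_integral[OF t] by linarith
qed

lemma f'_pos: assumes t: "0 < t" "t < T" shows "f' t > 0"
proof -
  have "f' 0 < f' t"
  proof (rule DERIV_pos_imp_increasing[OF t(1)])
    fix x assume "0 \<le> x" "x \<le> t"
    then have x: "x \<in> {-T<..<T}" using t T_pos by auto
    have "real k * (cosh (f x) / sinh (f x)) * (1 + (f' x)\<^sup>2) > 0"
      using f_pos[OF x] k_pos by (intro mult_pos_pos divide_pos_pos) (auto simp: add_pos_nonneg)
    then show "\<exists>y. (f' has_real_derivative y) (at x) \<and> 0 < y" using f'_deriv[OF x] by blast
  qed
  then show ?thesis by (simp add: f'_0)
qed

lemma f_strict_mono: assumes "0 \<le> t1" "t1 < t2" "t2 < T" shows "f t1 < f t2"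
proof (rule DERIV_pos_imp_increasing_open[OF assms(2)])
  fix x assume "t1 < x" "x < t2"
  then show "\<exists>y. (f has_real_derivative y) (at x) \<and> 0 < y"
    using f_deriv[of x] f'_pos[of x] assms T_pos by force
next
  show "continuous_on {t1..t2} f"
    using assms by (intro continuous_at_imp_continuous_on ballI DERIV_isCont[OF f_deriv]) auto
qed

text \<open>
  The slope of the solution as a function of its value: on \<open>]0,T[\<close> the solution satisfies the
  autonomous first-order equation \<open>f' = speed f\<close>.
\<close>

definition speed :: "real \<Rightarrow> real" where
  "speed x = sqrt ((sinh x / sinh a) ^ (2 * k) - 1)"

lemma speed_arg_pos: "x > a \<Longrightarrow> (sinh x / sinh a) ^ (2 * k) > 1"
  using a_pos k_pos by (intro one_less_power) (auto simp: field_simps)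

lemma speed_pos: "x > a \<Longrightarrow> speed x > 0"
  using speed_arg_pos by (simp add: speed_def)

lemma f'_eq_speed: assumes "0 < t" "t < T" shows "f' t = speed (f t)"
proof -
  have "(f' t)\<^sup>2 = (sinh (f t) / sinh a) ^ (2 * k) - 1"
    using first_integral[of t] assms by auto
  then show ?thesis unfolding speed_def using f'_pos[OF assms]
    by (metis abs_of_pos real_sqrt_abs)
qed

lemma speed_deriv:
  assumes "x > a"
  shows "(speed has_real_derivative
     real k * (cosh x / sinh x) * (sinh x / sinh a) ^ (2 * k) / speed x) (at x)"
proof -
  have k: "2 * k = Suc (2 * k - 1)" using k_pos by simp
  have s: "sinh a > 0" "sinh x > 0" using assms a_pos by auto
  have *: "(sinh x / sinh a) ^ (2 * k) = (sinh x / sinh a) ^ (2 * k - 1) * (sinh x / sinh a)"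
    by (metis k power_Suc2)
  have "((\<lambda>x. (sinh x / sinh a) ^ (2 * k) - 1) has_real_derivative
      real (2 * k) * (sinh x / sinh a) ^ (2 * k - 1) * (cosh x / sinh a)) (at x)"
    using s by (auto intro!: derivative_eq_intros)
  also have "real (2 * k) * (sinh x / sinh a) ^ (2 * k - 1) * (cosh x / sinh a) =
     2 * real k * (cosh x / sinh x) * (sinh x / sinh a) ^ (2 * k)"
    unfolding * using s by (simp add: field_simps)
  finally have "((\<lambda>x. (sinh x / sinh a) ^ (2 * k) - 1) has_real_derivative
     2 * real k * (cosh x / sinh x) * (sinh x / sinh a) ^ (2 * k)) (at x)" .
  from DERIV_chain2[OF DERIV_real_sqrt this] speed_arg_pos[OF assms]
  have "((\<lambda>x. sqrt ((sinh x / sinh a) ^ (2 * k) - 1)) has_real_derivative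
    inverse (speed x) / 2 * (2 * real k * (cosh x / sinh x) * (sinh x / sinh a) ^ (2 * k))) (at x)"
    by (simp add: speed_def)
  then show ?thesis unfolding speed_def[symmetric] by (simp add: field_simps)
qed

text \<open>
  A solution that stays bounded on \<open>]0,T[\<close> extends beyond T. No existence theorem for differential
  equations is needed: the time \<open>G x\<close> at which the value x is reached is the integral of \<open>1 / speed\<close>,
  and its inverse function continues the solution.
\<close>

lemma extension_past_bound:
  assumes B: "\<And>t. 0 < t \<Longrightarrow> t < T \<Longrightarrow> f t \<le> B"
  obtains T' h where "T' > T" "profile_solution (Suc k) a {-T<..<T'} h"
    "\<And>t. t \<in> {-T<..<T} \<Longrightarrow> h t = f t"
proof -
  define t0 where "t0 = T / 2"
  have t0: "0 < t0" "t0 < T" using T_pos by (auto simp: t0_def)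
  define x0 where "x0 = f t0"
  have x0: "x0 > a" using f_strict_mono[of 0 t0] t0 by (simp add: x0_def f_0)
  \<comment> \<open>leaving room above the bound B makes the range of G reach strictly beyond time T\<close>
  define X where "X = B + 1"
  have X: "x0 < X" "f t < X" if "0 < t" "t < T" for t
    using B[OF t0] B[OF that] by (auto simp: X_def x0_def)
  have x0X: "x0 < X" using X t0 by auto
  define G where "G = (\<lambda>x. integral {x0..x} (\<lambda>x. 1 / speed x))"
  have cont: "continuous_on {x0..X} (\<lambda>x. 1 / speed x)"
  proof (intro continuous_at_imp_continuous_on ballI)
    fix x assume "x \<in> {x0..X}"
    then have "x > a" using x0 by auto
    then show "isCont (\<lambda>x. 1 / speed x) x"
      using DERIV_isCont[OF speed_deriv] speed_pos[of x] by (auto intro!: continuous_intros)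
  qed
  have dG: "(G has_real_derivative 1 / speed x) (at x within {x0..X})" if "x \<in> {x0..X}" for x
    unfolding G_def by (rule integral_has_real_derivative[OF cont that])
  have dG': "(G has_real_derivative 1 / speed x) (at x)" if "x0 < x" "x < X" for x
    using dG[of x] that by (metis at_within_Icc_at atLeastAtMost_iff less_imp_le)
  have contG: "continuous_on {x0..X} G"
    using dG by (meson DERIV_continuous_on)
  have monoG: "G x < G y" if "x0 \<le> x" "x < y" "y \<le> X" for x y
  proof (rule DERIV_pos_imp_increasing_open[OF that(2)])
    show "continuous_on {x..y} G" using contG that by (auto intro: continuous_on_subset)
    fix z assume "x < z" "z < y"
    then show "\<exists>w. (G has_real_derivative w) (at z) \<and> 0 < w"
      using dG'[of z] speed_pos[of z] x0 that by (intro exI[of _ "1 / speed z"]) auto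
  qed
  have injG: "inj_on G {x0..X}"
    by (rule inj_onI) (metis atLeastAtMost_iff linorder_neqE_linordered_idom monoG order_less_irrefl)
  have G0: "G x0 = 0" by (simp add: G_def)
  define inv where "inv = the_inv_into {x0..X} G"
  have invG: "inv (G x) = x" if "x \<in> {x0..X}" for x
    using the_inv_into_f_f[OF injG that] by (simp add: inv_def)
  have surj: "\<exists>x. x0 \<le> x \<and> x \<le> X \<and> G x = y" if "0 \<le> y" "y \<le> G X" for y
    using IVT'[of G x0 y X] contG that G0 x0X by auto
  have inv_mem: "x0 < inv y" "inv y < X" "G (inv y) = y" if y: "0 < y" "y < G X" for y
  proof -
    obtain x where x: "x0 \<le> x" "x \<le> X" "G x = y" using surj[of y] y by auto
    have "x \<noteq> x0" "x \<noteq> X" using x y G0 by auto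
    then show "x0 < inv y" "inv y < X" "G (inv y) = y" using x invG[of x] by auto
  qed
  have cinv: "isCont inv y" if y: "0 < y" "y < G X" for y
  proof -
    obtain x where x: "x0 \<le> x" "x \<le> X" "G x = y" using surj[of y] y by auto
    have "x \<noteq> x0" "x \<noteq> X" using x y G0 by auto
    then have x': "x0 < x" "x < X" using x by auto
    define p where "p = (x0 + x) / 2"
    define q where "q = (x + X) / 2"
    have pq: "x0 < p" "p < x" "x < q" "q < X" using x' by (auto simp: p_def q_def)
    have "isCont inv (G x)"
    proof (rule isCont_inverse_function2[of p x q])
      show "inv (G z) = z" if "p \<le> z" "z \<le> q" for z
        using that pq by (intro invG) auto
      show "isCont G z" if "p \<le> z" "z \<le> q" for z
        using that pq by (intro DERIV_isCont[OF dG']) auto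
    qed (use pq in auto)
    then show ?thesis using x by simp
  qed
  have dinv: "(inv has_real_derivative speed (inv y)) (at y)" if y: "0 < y" "y < G X" for y
  proof -
    have "(inv has_real_derivative inverse (1 / speed (inv y))) (at y)"
    proof (rule DERIV_inverse_function[where f = G and a = 0 and b = "G X"])
      show "(G has_real_derivative 1 / speed (inv y)) (at (inv y))"
        using inv_mem[OF y] by (intro dG')
      show "1 / speed (inv y) \<noteq> 0" using speed_pos[of "inv y"] inv_mem(1)[OF y] x0 by simp
    qed (use y inv_mem cinv in auto)
    then show ?thesis by simp
  qed
  \<comment> \<open>along the solution, G measures the time elapsed since t0\<close>
  have Gf: "G (f t) = t - t0" if t: "t0 \<le> t" "t < T" for t
  proof -
    have fm: "f u \<in> {x0..<X}" "u > t0 \<Longrightarrow> f u > x0" if "t0 \<le> u" "u < T" for u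
      using f_strict_mono[of t0 u] X(2)[of u] that t0 by (cases "u = t0"; force simp: x0_def)+
    have cf: "continuous_on {t0..t} f"
      using t t0 by (intro continuous_at_imp_continuous_on ballI DERIV_isCont[OF f_deriv]) auto
    define \<Phi> where "\<Phi> = (\<lambda>u. G (f u) - u)"
    have "\<Phi> t = \<Phi> t0"
    proof (cases "t0 = t")
      case False
      show ?thesis
      proof (rule DERIV_isconst_end[of t0 t \<Phi>])
        show "t0 < t" using False t by simp
        have "continuous_on {t0..t} (G \<circ> f)"
          using fm t by (intro continuous_on_compose cf continuous_on_subset[OF contG]) force
        then show "continuous_on {t0..t} \<Phi>"
          by (auto simp: \<Phi>_def o_def intro!: continuous_intros)
        fix u assume u: "t0 < u" "u < t"
        have fu: "x0 < f u" "f u < X" using fm[of u] u t by auto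
        have "(\<Phi> has_real_derivative 1 / speed (f u) * f' u - 1) (at u)"
          unfolding \<Phi>_def using u t t0 T_pos fu
          by (intro DERIV_diff DERIV_ident DERIV_chain2[OF dG'] f_deriv) auto
        moreover have "f' u = speed (f u)" using u t t0 by (intro f'_eq_speed) auto
        ultimately show "(\<Phi> has_real_derivative 0) (at u)"
          using speed_pos[of "f u"] fu x0 by simp
      qed
    qed simp
    then show ?thesis by (simp add: \<Phi>_def x0_def[symmetric] G0)
  qed
  define T' where "T' = t0 + G X"
  have T': "T' > T"
  proof -
    have BX: "x0 \<le> B" "B < X" using B[OF t0] by (auto simp: X_def x0_def)
    have "t - t0 \<le> G B" if "t0 < t" "t < T" for t
    proof -
      have "x0 \<le> f t" using f_strict_mono[of t0 t] that t0 by (simp add: x0_def)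
      then have "G (f t) \<le> G B"
        using monoG[of "f t" B] B[of t] that t0 BX by (cases "f t = B") auto
      then show ?thesis using Gf[of t] that by simp
    qed
    then have "t \<le> t0 + G B" if "t0 < t" "t < T" for t using that by (simp add: algebra_simps)
    then have "T \<le> t0 + G B" using t0 by (meson dense_le_bounded)
    also have "\<dots> < T'" using monoG[of B X] BX by (simp add: T'_def)
    finally show ?thesis .
  qed
  \<comment> \<open>both branches of h agree on the overlap between t0 and T, so h is a solution across T\<close>
  define h where "h = (\<lambda>t. if t < T then f t else inv (t - t0))"
  define h' where "h' = (\<lambda>t. if t < T then f' t else speed (inv (t - t0)))"
  have h_inv: "h t = inv (t - t0)" "h' t = speed (inv (t - t0))" if t: "t0 < t" "t < T'" for t
  proof -
    have *: "inv (t - t0) = f t" if "t < T"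
    proof -
      have "f t \<in> {x0..X}"
        using f_strict_mono[of t0 t] X(2)[of t] t that t0 by (auto simp: x0_def)
      then show ?thesis using Gf[of t] invG[of "f t"] t that by simp
    qed
    then show "h t = inv (t - t0)" by (simp add: h_def)
    show "h' t = speed (inv (t - t0))"
      using * f'_eq_speed[of t] t t0 by (simp add: h'_def)
  qed
  have "profile_solution (Suc k) a {-T<..<T'} h"
    unfolding profile_solution_def
  proof (intro conjI exI[of _ h'] ballI)
    show "h 0 = a" "h' 0 = 0" using T_pos by (auto simp: h_def h'_def f_0 f'_0)
    fix t assume t: "t \<in> {-T<..<T'}"
    consider "t < T" | "t0 < t" using t0 by linarith
    then have "h t > 0 \<and> (h has_real_derivative h' t) (at t) \<and> (h' has_real_derivative
         real k * (cosh (h t) / sinh (h t)) * (1 + (h' t)\<^sup>2)) (at t)"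
    proof cases
      case 1
      then have t: "t \<in> {-T<..<T}" using t by auto
      have "(h has_real_derivative f' t) (at t)"
        by (rule has_field_derivative_transform_within_open[OF f_deriv[OF t], of "{..<T}"])
          (use 1 in \<open>auto simp: h_def\<close>)
      moreover have "(h' has_real_derivative real k * (cosh (f t) / sinh (f t)) * (1 + (f' t)\<^sup>2)) (at t)"
        by (rule has_field_derivative_transform_within_open[OF f'_deriv[OF t], of "{..<T}"])
          (use 1 in \<open>auto simp: h'_def\<close>)
      ultimately show ?thesis using f_pos[OF t] 1 by (simp add: h_def h'_def)
    next
      case 2
      let ?y = "t - t0"
      have y: "0 < ?y" "?y < G X" using 2 t by (auto simp: T'_def)
      have iy: "inv ?y > a" using inv_mem[OF y] x0 by simp
      have d1: "((\<lambda>t. inv (t - t0)) has_real_derivative speed (inv ?y)) (at t)"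
      proof -
        have "((\<lambda>t. t - t0) has_real_derivative 1) (at t)" by (auto intro!: derivative_eq_intros)
        from DERIV_chain2[where f = inv and g = "\<lambda>t. t - t0", OF dinv[OF y] this]
        show ?thesis by simp
      qed
      have "(h has_real_derivative speed (inv ?y)) (at t)"
        by (rule has_field_derivative_transform_within_open[OF d1, of "{t0<..<T'}"])
          (use 2 t h_inv in auto)
      moreover have d2: "((\<lambda>t. speed (inv (t - t0))) has_real_derivative
          real k * (cosh (inv ?y) / sinh (inv ?y)) * (1 + (speed (inv ?y))\<^sup>2)) (at t)"
        using DERIV_chain2[where f = speed and g = "\<lambda>t. inv (t - t0)", OF speed_deriv[OF iy] d1] speed_pos[OF iy] speed_arg_pos[OF iy]
        by (simp add: speed_def)
      then have "(h' has_real_derivative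
          real k * (cosh (inv ?y) / sinh (inv ?y)) * (1 + (speed (inv ?y))\<^sup>2)) (at t)"
        by (rule has_field_derivative_transform_within_open[of _ _ _ "{t0<..<T'}"])
          (use 2 t h_inv in auto)
      ultimately show ?thesis using iy a_pos h_inv[of t] 2 t by simp
    qed
    then show "h t > 0" "(h has_real_derivative h' t) (at t)"
      "(h' has_real_derivative (real (Suc k) - 1) * (cosh (h t) / sinh (h t)) * (1 + (h' t)\<^sup>2)) (at t)"
      by auto
  qed
  moreover have "h t = f t" if "t \<in> {-T<..<T}" for t using that by (simp add: h_def)
  ultimately show ?thesis using that T' by blast
qed

end

section \<open>Volume and total curvatures\<close>

text \<open>
  The measure of a shell outside the unit ball is bounded below by its logarithmic thickness. This
  estimate takes the place of integration in polar coordinates.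
\<close>

lemma shell_measure_lower_bound:
  fixes r1 r2 :: real
  assumes r: "1 \<le> r1" "r1 \<le> r2"
  shows "emeasure lborel {y :: real^'n. r1 < norm y \<and> norm y < r2} \<ge>
    ennreal (measure lborel (ball (0 :: real^'n) 1) * (ln r2 - ln r1))"
proof -
  let ?B = "\<lambda>r. measure lborel (ball (0 :: real^'n) r)"
  have B: "?B r = ?B 1 * r ^ CARD('n)" if "r \<ge> 0" for r
    using that by (simp add: content_ball)
  have Bc: "measure lborel (cball (0 :: real^'n) r) = ?B r" if "r \<ge> 0" for r
    using that by (simp add: content_ball content_cball)
  have eq: "{y :: real^'n. r1 < norm y \<and> norm y < r2} = ball 0 r2 - (cball 0 r1 \<inter> ball 0 r2)"
    by auto
  have "measure lborel {y :: real^'n. r1 < norm y \<and> norm y < r2} \<ge>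
      measure lborel (ball (0::real^'n) r2) - measure lborel (cball (0::real^'n) r1 \<inter> ball 0 r2)"
    unfolding eq
    using emeasure_lborel_ball_finite[of "0 :: real^'n" r2] by (subst measure_Diff) auto
  moreover have "measure lborel (cball (0::real^'n) r1 \<inter> ball 0 r2) \<le> measure lborel (cball (0::real^'n) r1)"
    using emeasure_lborel_cball_finite[of "0 :: real^'n" r1]
    by (intro measure_mono_fmeasurable) (auto simp: fmeasurable_def)
  moreover have "?B 1 * (ln r2 - ln r1) \<le> ?B 1 * (r2 ^ CARD('n) - r1 ^ CARD('n))"
  proof (rule mult_left_mono)
    have n: "CARD('n) = Suc (CARD('n) - 1)" by simp
    have "ln r2 - ln r1 \<le> (r2 - r1) / r1"
      using ln_diff_le[of r2 r1] r by simp
    also have "\<dots> \<le> r2 - r1" using r by (simp add: divide_le_eq mult_le_cancel_left1)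
    also have "\<dots> = (r2 - r1) * 1" by simp
    also have "\<dots> \<le> (r2 - r1) * r1 ^ (CARD('n) - 1)"
      using r by (intro mult_left_mono one_le_power) auto
    also have "\<dots> = r2 * r1 ^ (CARD('n) - 1) - r1 * r1 ^ (CARD('n) - 1)"
      by (simp add: algebra_simps)
    also have "\<dots> \<le> r2 * r2 ^ (CARD('n) - 1) - r1 * r1 ^ (CARD('n) - 1)"
      using r by (intro diff_right_mono mult_left_mono power_mono) auto
    also have "\<dots> = r2 ^ CARD('n) - r1 ^ CARD('n)" by (metis n power_Suc)
    finally show "ln r2 - ln r1 \<le> r2 ^ CARD('n) - r1 ^ CARD('n)" .
  qed simp
  ultimately have "?B 1 * (ln r2 - ln r1) \<le> measure lborel {y :: real^'n. r1 < norm y \<and> norm y < r2}"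
    using B[of r2] B[of r1] Bc[of r1] r by (simp add: right_diff_distrib)
  moreover have "emeasure lborel {y :: real^'n. r1 < norm y \<and> norm y < r2} < \<infinity>"
  proof -
    have "emeasure lborel {y :: real^'n. r1 < norm y \<and> norm y < r2} \<le> emeasure lborel (ball (0 :: real^'n) r2)"
      by (rule emeasure_mono) auto
    also have "\<dots> < \<infinity>" by (rule emeasure_lborel_ball_finite)
    finally show ?thesis .
  qed
  ultimately show ?thesis
    by (subst emeasure_eq_ennreal_measure) (auto intro: ennreal_leI)
qed

lemma ennreal_eq_infinity_if_linear_lower_bound:
  assumes "c > 0" "\<And>z. z \<ge> z0 \<Longrightarrow> ennreal (c * z) \<le> I"
  shows "I = \<infinity>"
proof (rule ccontr)
  assume "I \<noteq> \<infinity>"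
  then obtain r where r: "I = ennreal r" "r \<ge> 0" by (cases I) auto
  define z where "z = max z0 ((r + 1) / c)"
  have "c * z \<ge> r + 1" using assms(1) by (simp add: z_def field_simps max_def)
  moreover have "ennreal (c * z) \<le> ennreal r" using assms(2)[of z] r by (simp add: z_def)
  ultimately show False using r(2) by (simp add: ennreal_le_iff)
qed

context catenoid_profile begin

lemma profile_unbounded:
  assumes "maximal_profile (Suc k) a T f"
  obtains t where "0 < t" "t < T" "f t > B"
proof -
  have "\<exists>t. 0 < t \<and> t < T \<and> f t > B"
  proof (rule ccontr)
    assume "\<not> ?thesis"
    then have "f t \<le> B" if "0 < t" "t < T" for t using that by force
    then obtain T' h where h: "T' > T" "profile_solution (Suc k) a {-T<..<T'} h"
      "\<And>t. t \<in> {-T<..<T} \<Longrightarrow> h t = f t" by (rule extension_past_bound) blast+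
    have ext: "open {-T<..<T'} \<and> connected {-T<..<T'} \<and> {-T<..<T} \<subseteq> {-T<..<T'} \<and>
        profile_solution (Suc k) a {-T<..<T'} h \<and> (\<forall>t\<in>{-T<..<T}. h t = f t)"
      using h(1,2) by (intro conjI ballI h(3)) auto
    have M: "\<forall>J h. open J \<and> connected J \<and> {-T<..<T} \<subseteq> J \<and> profile_solution (Suc k) a J h \<and>
        (\<forall>t\<in>{-T<..<T}. h t = f t) \<longrightarrow> J = {-T<..<T}"
      using assms unfolding maximal_profile_def by (rule conjunct2)
    have "{-T<..<T'} = {-T<..<T}"
      by (rule M[THEN spec, THEN spec, THEN mp, OF ext])
    moreover have "T \<in> {-T<..<T'}" using h(1) T_pos by simp
    ultimately show False by simp
  qed
  then show thesis using that by blast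
qed

lemma sqrt_first_integral:
  assumes "t \<in> {-T<..<T}"
  shows "sqrt (1 + (f' t)\<^sup>2) = (sinh (f t) / sinh a) ^ k"
proof -
  have "1 + (f' t)\<^sup>2 = ((sinh (f t) / sinh a) ^ k)\<^sup>2"
    using first_integral[OF assms] by (simp add: power_mult[symmetric] mult.commute)
  then show ?thesis using f_pos[OF assms] a_pos by simp
qed

text \<open>The density of the Riemannian measure in the chart, with \<open>1 + f'\<^sup>2\<close> eliminated.\<close>

definition volume_density :: "real^'n \<Rightarrow> real" where
  "volume_density y = sinh (f (ln (norm y))) ^ k * (sinh (f (ln (norm y))) / sinh a) ^ k / norm y ^ CARD('n)"

lemma sqrt_det_gram_catenoid:
  fixes y :: "real^'n"
  assumes "CARD('n) = Suc k" "y \<in> annulus T"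
  shows "sqrt (det (gram_matrix (pullback_metric hyp_line_metric (catenoid_chart f) y))) = volume_density y"
  using assms annulus_D[OF assms(2)] unfolding sqrt_det_gram_chart[OF assms(2)]
  by (simp add: volume_density_def sqrt_first_integral)

lemma continuous_on_f: "continuous_on {-T<..<T} f"
  by (intro continuous_at_imp_continuous_on ballI DERIV_isCont[OF f_deriv])

lemma continuous_on_volume_density: "continuous_on (annulus T) volume_density"
proof -
  have "continuous_on (annulus T) (\<lambda>y::real^'a. f (ln (norm y)))"
    by (rule continuous_on_compose2[OF continuous_on_f])
      (auto intro!: continuous_intros dest: annulus_D)
  then show ?thesis unfolding volume_density_def[abs_def]
    using a_pos by (intro continuous_intros) (auto dest: annulus_D)
qed

lemma volume_density_nonneg: "y \<in> annulus T \<Longrightarrow> volume_density y \<ge> 0"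
  using annulus_D(2)[of y] f_pos a_pos by (simp add: volume_density_def less_imp_le)

lemma space_catenoid_measure:
  "space (catenoid_measure T f :: ((real^'n) \<times> real) measure) = catenoid T f"
  by (simp add: catenoid_measure_def riemannian_measure_def space_restrict_space catenoid_chart_image)

lemma sets_catenoid_measure:
  "sets (catenoid_measure T f :: ((real^'n) \<times> real) measure) = sets (restrict_space borel (catenoid T f))"
  by (simp add: catenoid_measure_def riemannian_measure_def catenoid_chart_image)

lemma measurable_catenoid_chart:
  "catenoid_chart f \<in> measurable (restrict_space lborel (annulus T :: (real^'n) set))
     (restrict_space borel (catenoid_chart f ` annulus T))"
proof (rule measurable_restrict_space2)
  have "continuous_on (annulus T) (catenoid_chart f :: real^'n \<Rightarrow> _)"
    using has_derivative_chart has_derivative_continuous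
    by (intro continuous_at_imp_continuous_on) blast
  then show "catenoid_chart f \<in> borel_measurable (restrict_space lborel (annulus T :: (real^'n) set))"
    using borel_measurable_continuous_on_restrict
    by (subst measurable_cong_sets[OF sets_restrict_space_cong[OF sets_lborel] refl]) blast
qed (auto simp: space_restrict_space)

lemma nn_integral_catenoid_measure:
  fixes g :: "(real^'n) \<times> real \<Rightarrow> ennreal"
  assumes card: "CARD('n) = Suc k" and g: "g \<in> borel_measurable (catenoid_measure T f)"
  shows "(\<integral>\<^sup>+ p. g p \<partial>catenoid_measure T f) =
    (\<integral>\<^sup>+ y. ennreal (volume_density y) * g (catenoid_chart f y) * indicator (annulus T) y \<partial>lborel)"
proof -
  let ?A = "annulus T :: (real^'n) set"
  let ?L = "restrict_space lborel ?A"
  let ?d = "\<lambda>y. ennreal (sqrt (det (gram_matrix (pullback_metric hyp_line_metric (catenoid_chart f) y))))"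
  have d: "?d y = ennreal (volume_density y)" if "y \<in> space ?L" for y
    using that card by (simp add: space_restrict_space sqrt_det_gram_catenoid)
  have "(\<lambda>y. ennreal (volume_density y)) \<in> borel_measurable ?L"
    using borel_measurable_continuous_on_restrict[OF continuous_on_volume_density]
    by (intro measurable_compose[OF _ measurable_ennreal])
      (subst measurable_cong_sets[OF sets_restrict_space_cong[OF sets_lborel] refl], blast)
  then have md: "?d \<in> borel_measurable ?L"
    by (subst measurable_cong[OF d])
  have mphi: "catenoid_chart f \<in> measurable (density ?L ?d) (restrict_space borel (catenoid_chart f ` ?A))"
    using measurable_catenoid_chart by simp
  have g': "g \<in> borel_measurable (restrict_space borel (catenoid_chart f ` ?A))"
    using g by (subst (asm) measurable_cong_sets[OF sets_catenoid_measure refl])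
      (simp add: catenoid_chart_image)
  have mg: "(\<lambda>y. g (catenoid_chart f y)) \<in> borel_measurable ?L"
    by (rule measurable_compose[OF measurable_catenoid_chart g'])
  have "(\<integral>\<^sup>+ p. g p \<partial>catenoid_measure T f) = (\<integral>\<^sup>+ y. g (catenoid_chart f y) \<partial>density ?L ?d)"
    unfolding catenoid_measure_def riemannian_measure_def by (rule nn_integral_distr[OF mphi g[unfolded catenoid_measure_def riemannian_measure_def]])
  also have "\<dots> = (\<integral>\<^sup>+ y. ?d y * g (catenoid_chart f y) \<partial>?L)"
    by (rule nn_integral_density[OF md mg])
  also have "\<dots> = (\<integral>\<^sup>+ y. ennreal (volume_density y) * g (catenoid_chart f y) \<partial>?L)"
    by (rule nn_integral_cong) (simp only: d)
  also have "\<dots> = (\<integral>\<^sup>+ y. ennreal (volume_density y) * g (catenoid_chart f y) * indicator ?A y \<partial>lborel)"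
    by (rule nn_integral_restrict_space) (simp add: annulus_borel)
  finally show ?thesis .
qed

text \<open>
  The volume of the part of the catenoid where f runs from x to \<open>x + 1\<close>. The slope there is at most
  \<open>(sinh (x + 1) / sinh a)\<^sup>k\<close>, which bounds the thickness of this part in t from below, and the density there
  is at least a constant multiple of \<open>(sinh x)\<^bsup>2k\<^esup>\<close>.
\<close>

lemma shell_volume:
  assumes card: "CARD('n) = Suc k" and max: "maximal_profile (Suc k) a T f" and x: "x > a"
  defines "\<omega> \<equiv> measure lborel (ball (0 :: real^'n) 1)"
  shows "ennreal (\<omega> * exp (- T) ^ CARD('n) * ((sinh x)\<^sup>2 / sinh (x + 1)) ^ k) \<le>
     (\<integral>\<^sup>+ y. ennreal (volume_density (y :: real^'n)) * indicator (annulus T) y \<partial>lborel)"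
proof -
  obtain t where t: "0 < t" "t < T" "f t > x + 1" by (rule profile_unbounded[OF max])
  have cont: "continuous_on {0..t} f"
    using t by (intro continuous_on_subset[OF continuous_on_f]) auto
  obtain t1 where t1: "0 \<le> t1" "t1 \<le> t" "f t1 = x"
    using IVT'[of f 0 x t] cont t x by (auto simp: f_0)
  obtain t2 where t2: "0 \<le> t2" "t2 \<le> t" "f t2 = x + 1"
    using IVT'[of f 0 "x + 1" t] cont t x by (auto simp: f_0)
  have t12: "t1 < t2"
    using f_strict_mono[of t2 t1] t1 t2 t by (cases t1 t2 rule: linorder_cases) auto
  have "\<exists>z. t1 < z \<and> z < t2 \<and> f t2 - f t1 = (t2 - t1) * f' z"
    using t1 t2 t by (intro MVT2[OF t12]) (auto intro!: f_deriv)
  then obtain z where z: "t1 < z" "z < t2" "f t2 - f t1 = (t2 - t1) * f' z" by blast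
  have zT: "z \<in> {-T<..<T}" using z t1 t2 t by auto
  have S: "sinh a > 0" "sinh x > 0" "sinh (x + 1) > 0" using a_pos x by auto
  have "f' z \<le> sqrt (1 + (f' z)\<^sup>2)" by (rule real_le_rsqrt) simp
  also have "\<dots> = (sinh (f z) / sinh a) ^ k" by (rule sqrt_first_integral[OF zT])
  also have "\<dots> \<le> (sinh (x + 1) / sinh a) ^ k"
    using f_strict_mono[of z t2] z t1 t2 t S f_pos[OF zT]
    by (intro power_mono divide_right_mono) auto
  finally have "1 \<le> (t2 - t1) * (sinh (x + 1) / sinh a) ^ k"
    using z(3) t1 t2 t12 mult_left_mono[of "f' z" "(sinh (x + 1) / sinh a) ^ k" "t2 - t1"] by simp
  then have width: "(sinh a / sinh (x + 1)) ^ k \<le> t2 - t1"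
    using S by (simp add: power_divide field_simps)
  define c where "c = sinh x ^ k * (sinh x / sinh a) ^ k * exp (- T) ^ CARD('n)"
  have c: "c \<ge> 0" using S by (simp add: c_def)
  define H where "H = {y :: real^'n. exp t1 < norm y \<and> norm y < exp t2}"
  have Hm: "H \<in> sets borel" unfolding H_def
    by (intro borel_open open_Collect_conj open_Collect_less continuous_intros)
  have low: "c \<le> volume_density y" "y \<in> annulus T" if "y \<in> H" for y
  proof -
    have ny: "norm y > 0" "y \<noteq> 0" using that less_trans[OF exp_gt_zero, of t1 "norm y"] by (auto simp: H_def)
    have ne: "norm y = exp (ln (norm y))" using ny by simp
    have "exp t1 < exp (ln (norm y))" "exp (ln (norm y)) < exp t2"
      unfolding ne[symmetric] using that by (auto simp: H_def)
    then have l: "t1 < ln (norm y)" "ln (norm y) < t2" by simp_all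
    have lT: "ln (norm y) \<in> {-T<..<T}" using l t1 t2 t by auto
    show "y \<in> annulus T"
    proof -
      have "exp (- T) < exp (ln (norm y))" "exp (ln (norm y)) < exp T" using lT by simp_all
      then show ?thesis unfolding ne[symmetric] by (simp add: annulus_def)
    qed
    have fx: "x \<le> f (ln (norm y))" using f_strict_mono[of t1 "ln (norm y)"] l t1 t2 t by simp
    have "norm y \<le> exp T" by (subst ne) (use lT in simp)
    then have "exp (- T) \<le> 1 / norm y" using ny by (simp add: exp_minus field_simps)
    then have e: "exp (- T) ^ CARD('n) \<le> (1 / norm y) ^ CARD('n)" by (intro power_mono) auto
    have g: "sinh x ^ k * (sinh x / sinh a) ^ k \<le> sinh (f (ln (norm y))) ^ k * (sinh (f (ln (norm y))) / sinh a) ^ k"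
      using fx S by (intro mult_mono power_mono divide_right_mono) (auto intro: order_trans[OF less_imp_le])
    have "c \<le> sinh (f (ln (norm y))) ^ k * (sinh (f (ln (norm y))) / sinh a) ^ k * (1 / norm y) ^ CARD('n)"
      unfolding c_def by (rule mult_mono[OF g e]) (use S f_pos[OF lT] in auto)
    then show "c \<le> volume_density y" by (simp add: volume_density_def power_divide)
  qed
  have "\<omega> * exp (- T) ^ CARD('n) * ((sinh x)\<^sup>2 / sinh (x + 1)) ^ k = c * (\<omega> * (sinh a / sinh (x + 1)) ^ k)"
    unfolding c_def using S by (simp add: power_divide power_mult_distrib power2_eq_square)
  also have "\<dots> \<le> c * (\<omega> * (t2 - t1))"
    using width c by (intro mult_left_mono) (auto simp: \<omega>_def)
  finally have "ennreal (\<omega> * exp (- T) ^ CARD('n) * ((sinh x)\<^sup>2 / sinh (x + 1)) ^ k) \<le> ennreal (c * (\<omega> * (t2 - t1)))"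
    by (rule ennreal_leI)
  also have "\<dots> = ennreal c * ennreal (\<omega> * (ln (exp t2) - ln (exp t1)))"
    using c by (simp add: ennreal_mult')
  also have "\<dots> \<le> ennreal c * emeasure lborel H"
    unfolding H_def \<omega>_def using t1 t12 by (intro mult_left_mono shell_measure_lower_bound) auto
  also have "\<dots> = (\<integral>\<^sup>+ y. ennreal c * indicator H y \<partial>lborel)"
    using Hm by (simp add: nn_integral_cmult_indicator)
  also have "\<dots> \<le> (\<integral>\<^sup>+ y. ennreal (volume_density (y :: real^'n)) * indicator (annulus T) y \<partial>lborel)"
    by (intro nn_integral_mono) (auto simp: indicator_def low intro!: ennreal_leI)
  finally show ?thesis .
qed

lemma catenoid_volume_infinite:
  assumes card: "CARD('n) = Suc k" and max: "maximal_profile (Suc k) a T f"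
  shows "emeasure (catenoid_measure T f) (catenoid T f :: ((real^'n) \<times> real) set) = \<infinity>"
proof -
  let ?M = "catenoid_measure T f :: ((real^'n) \<times> real) measure"
  have "emeasure ?M (catenoid T f) = (\<integral>\<^sup>+ p. 1 \<partial>?M)"
    by (simp add: space_catenoid_measure)
  also have "\<dots> = (\<integral>\<^sup>+ y. ennreal (volume_density (y :: real^'n)) * indicator (annulus T) y \<partial>lborel)"
    by (subst nn_integral_catenoid_measure[OF card]) auto
  also have "\<dots> = \<infinity>"
  proof -
    \<comment> \<open>the addition theorem for sinh gives sinh (x + 1) <= K sinh x for x > a\<close>
    define K where "K = cosh 1 + cosh a / sinh a * sinh 1"
    define \<omega> where "\<omega> = measure lborel (ball (0 :: real^'n) 1)"
    define c where "c = \<omega> * exp (- T) ^ CARD('n) / K"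
    have S: "sinh a > 0" using a_pos by simp
    have K: "K > 0" using S by (auto simp: K_def intro!: add_pos_nonneg)
    have "\<omega> > 0" by (simp add: \<omega>_def content_ball unit_ball_vol_pos)
    then have c: "c > 0" using K by (simp add: c_def)
    show ?thesis
    proof (rule ennreal_eq_infinity_if_linear_lower_bound[OF c])
      fix z assume z: "z \<ge> max K (sinh (a + 1))"
      define x where "x = arsinh z"
      have x: "sinh x = z" by (simp add: x_def)
      have "sinh a < sinh x" using z x by (smt (verit) max.bounded_iff sinh_real_less_iff)
      then have xa: "x > a" by simp
      have z0: "z > 0" using z K by simp
      have "cosh x / sinh x \<le> cosh a / sinh a" using a_pos xa by (intro cosh_over_sinh_antimono) auto
      then have "cosh x \<le> cosh a / sinh a * z" using z0 by (simp add: x field_simps)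
      then have "cosh x * sinh 1 \<le> cosh a / sinh a * z * sinh 1" by (intro mult_right_mono) auto
      then have "sinh (x + 1) \<le> K * z" by (simp add: sinh_add x K_def algebra_simps)
      moreover have "sinh (x + 1) > 0" using xa a_pos by simp
      ultimately have "z\<^sup>2 / (K * z) \<le> z\<^sup>2 / sinh (x + 1)" using K z0 by (intro divide_left_mono) auto
      then have q: "z / K \<le> (sinh x)\<^sup>2 / sinh (x + 1)" using z0 by (simp add: x power2_eq_square)
      have "z / K \<ge> 1" using z K by simp
      then have "z / K \<le> (z / K) ^ k" using k_pos by (intro self_le_power) auto
      also have "\<dots> \<le> ((sinh x)\<^sup>2 / sinh (x + 1)) ^ k" using q z0 K by (intro power_mono) auto
      finally have "c * z \<le> \<omega> * exp (- T) ^ CARD('n) * ((sinh x)\<^sup>2 / sinh (x + 1)) ^ k"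
        using mult_left_mono[of "z / K" "((sinh x)\<^sup>2 / sinh (x + 1)) ^ k" "\<omega> * exp (- T) ^ CARD('n)"] \<open>\<omega> > 0\<close>
        by (simp add: c_def)
      then have "ennreal (c * z) \<le> ennreal (\<omega> * exp (- T) ^ CARD('n) * ((sinh x)\<^sup>2 / sinh (x + 1)) ^ k)"
        by (rule ennreal_leI)
      also have "\<dots> \<le> (\<integral>\<^sup>+ y. ennreal (volume_density (y :: real^'n)) * indicator (annulus T) y \<partial>lborel)"
        unfolding \<omega>_def by (rule shell_volume[OF card max xa])
      finally show "ennreal (c * z) \<le> (\<integral>\<^sup>+ y. ennreal (volume_density (y :: real^'n)) * indicator (annulus T) y \<partial>lborel)" .
    qed
  qed
  finally show ?thesis .
qed

text \<open>The norm of the second fundamental form as a function of the height t.\<close>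

definition sff_profile :: "real \<Rightarrow> real" where
  "sff_profile t = sqrt (real k * (real k + 1)) * (cosh (f t) / sinh (f t)) / (sinh (f t) / sinh a) ^ k"

lemma sff_norm_catenoid:
  fixes y :: "real^'n"
  assumes card: "CARD('n) = Suc k" and y: "y \<in> annulus T" and nu: "catenoid_unit_normal T f \<nu>"
    and inj: "inj_on (catenoid_chart f) (annulus T :: (real^'n) set)"
  shows "catenoid_sff_norm T f \<nu> (catenoid_chart f y) = sff_profile (ln (norm y))"
proof -
  define t where "t = ln (norm y)"
  have t: "t \<in> {-T<..<T}" using annulus_D[OF y] by (simp add: t_def)
  define C where "C = cosh (f t) / sinh (f t)"
  have C: "C \<ge> 0" using f_pos[OF t] by (simp add: C_def)
  have P: "1 + (f' t)\<^sup>2 > 0" by (simp add: add_pos_nonneg)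
  have "catenoid_sff_norm T f \<nu> (catenoid_chart f y) =
    sqrt ((real k * C\<^sup>2 + (real k * C * (1 + (f' t)\<^sup>2) / (1 + (f' t)\<^sup>2))\<^sup>2) / (1 + (f' t)\<^sup>2))"
    unfolding sff_norm_chart[OF y nu inj] by (simp add: card t_def C_def)
  also have "real k * C * (1 + (f' t)\<^sup>2) / (1 + (f' t)\<^sup>2) = real k * C" using P by simp
  also have "real k * C\<^sup>2 + (real k * C)\<^sup>2 = (real k * (real k + 1)) * C\<^sup>2"
    by (simp add: power2_eq_square algebra_simps)
  also have "sqrt (real k * (real k + 1) * C\<^sup>2 / (1 + (f' t)\<^sup>2)) = sff_profile t"
    using C f_pos[OF t] a_pos by (simp add: sff_profile_def real_sqrt_divide real_sqrt_mult sqrt_first_integral[OF t] C_def)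
  finally show ?thesis by (simp add: t_def)
qed

text \<open>
  With \<open>r = sinh f / sinh a \<ge> 1\<close>, the product of density and curvature power carries the power
  \<open>r\<^bsup>2k - k(k+1)\<^esup>\<close>, whose exponent is not positive; all other factors are bounded.
\<close>

lemma sff_density_bound:
  fixes y :: "real^'n"
  assumes card: "CARD('n) = Suc k" and y: "y \<in> annulus T"
  shows "volume_density y * sff_profile (ln (norm y)) ^ CARD('n) \<le>
    sinh a ^ k * (sqrt (real k * (real k + 1)) * (cosh a / sinh a)) ^ CARD('n) * exp T ^ CARD('n)"
proof -
  define t where "t = ln (norm y)"
  have t: "t \<in> {-T<..<T}" using annulus_D[OF y] by (simp add: t_def)
  have ny: "norm y > 0" using annulus_norm_pos[OF y] .
  define C where "C = cosh (f t) / sinh (f t)"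
  define r where "r = sinh (f t) / sinh a"
  have fa: "f t \<ge> a" by (rule f_ge[OF t])
  have S: "sinh a > 0" "sinh (f t) > 0" using a_pos f_pos[OF t] by auto
  have r: "r \<ge> 1" using fa S by (simp add: r_def)
  have C: "0 \<le> C" "C \<le> cosh a / sinh a"
    using S cosh_over_sinh_antimono[OF a_pos fa] by (auto simp: C_def)
  have e: "1 / norm y \<le> exp T"
  proof -
    have "exp (- T) \<le> norm y" using y by (simp add: annulus_def)
    then show ?thesis using ny by (simp add: exp_minus field_simps)
  qed
  let ?q = "sqrt (real k * (real k + 1))"
  have "sinh (f t) = sinh a * r" using S by (simp add: r_def)
  then have "volume_density y * sff_profile t ^ CARD('n) =
     sinh a ^ k * r ^ k * r ^ k / norm y ^ CARD('n) * ((?q * C) / r ^ k) ^ CARD('n)"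
    unfolding volume_density_def sff_profile_def t_def[symmetric] C_def[symmetric] r_def[symmetric]
    by (simp add: power_mult_distrib)
  also have "\<dots> = sinh a ^ k * (?q * C) ^ CARD('n) * (1 / norm y) ^ CARD('n) * (r ^ k * r ^ k / (r ^ k) ^ CARD('n))"
    by (simp add: power_divide)
  also have "\<dots> \<le> sinh a ^ k * (?q * (cosh a / sinh a)) ^ CARD('n) * exp T ^ CARD('n) * 1"
  proof (intro mult_mono power_mono e order_refl C)
    have "r ^ k * r ^ k = (r ^ k) ^ 2" by (simp add: power2_eq_square)
    also have "\<dots> \<le> (r ^ k) ^ CARD('n)"
      using r k_pos card by (intro power_increasing one_le_power) auto
    finally show "r ^ k * r ^ k / (r ^ k) ^ CARD('n) \<le> 1" using r by simp
  qed (use S r C ny in auto)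
  finally show ?thesis by (simp add: t_def)
qed

lemma continuous_on_sff_profile: "continuous_on {-T<..<T} sff_profile"
  unfolding sff_profile_def[abs_def]
  using a_pos f_pos by (intro continuous_intros continuous_on_f) force+

lemma total_extrinsic_curvature_finite:
  fixes \<nu> :: "(real^'n) \<times> real \<Rightarrow> (real^'n) \<times> real"
  assumes card: "CARD('n) = Suc k" and nu: "catenoid_unit_normal T f \<nu>"
    and inj: "inj_on (catenoid_chart f) (annulus T :: (real^'n) set)"
  shows "integrable (catenoid_measure T f) (\<lambda>p. (catenoid_sff_norm T f \<nu> p) ^ CARD('n))"
proof -
  let ?M = "catenoid_measure T f :: ((real^'n) \<times> real) measure"
  let ?A = "annulus T :: (real^'n) set"
  have chart: "catenoid_sff_norm T f \<nu> (catenoid_chart f y) = sff_profile (snd (catenoid_chart f y))"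
    if "y \<in> ?A" for y
    using sff_norm_catenoid[OF card that nu inj] annulus_D[OF that] by (simp add: catenoid_chart_eq)
  have eq: "catenoid_sff_norm T f \<nu> p = sff_profile (snd p)" if "p \<in> catenoid T f" for p
    using that chart unfolding catenoid_chart_image[symmetric] by blast
  have "continuous_on (catenoid T f :: ((real^'n) \<times> real) set) (\<lambda>p. sff_profile (snd p) ^ CARD('n))"
    by (intro continuous_intros continuous_on_compose2[OF continuous_on_sff_profile])
      (auto simp: catenoid_def catenoid_map_def)
  then have "(\<lambda>p. sff_profile (snd p) ^ CARD('n)) \<in> borel_measurable ?M"
    using borel_measurable_continuous_on_restrict
    by (subst measurable_cong_sets[OF sets_catenoid_measure refl]) blast
  then have meas: "(\<lambda>p. (catenoid_sff_norm T f \<nu> p) ^ CARD('n)) \<in> borel_measurable ?M"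
    by (subst measurable_cong[where g = "\<lambda>p. sff_profile (snd p) ^ CARD('n)"])
      (auto simp: space_catenoid_measure eq)
  define C where "C = sinh a ^ k * (sqrt (real k * (real k + 1)) * (cosh a / sinh a)) ^ CARD('n) * exp T ^ CARD('n)"
  have pos: "sff_profile (ln (norm y)) \<ge> 0" if "y \<in> ?A" for y
    using annulus_D[OF that] f_pos a_pos by (simp add: sff_profile_def less_imp_le)
  have "(\<integral>\<^sup>+ p. norm ((catenoid_sff_norm T f \<nu> p) ^ CARD('n)) \<partial>?M) =
    (\<integral>\<^sup>+ y. ennreal (volume_density y) * ennreal (norm ((catenoid_sff_norm T f \<nu> (catenoid_chart f y)) ^ CARD('n)))
       * indicator ?A y \<partial>lborel)"
    using meas by (intro nn_integral_catenoid_measure[OF card]) auto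
  also have "\<dots> \<le> (\<integral>\<^sup>+ y. ennreal C * indicator ?A y \<partial>lborel)"
  proof (intro nn_integral_mono)
    fix y :: "real^'n"
    show "ennreal (volume_density y) * ennreal (norm ((catenoid_sff_norm T f \<nu> (catenoid_chart f y)) ^ CARD('n)))
       * indicator ?A y \<le> ennreal C * indicator ?A y"
    proof (cases "y \<in> ?A")
      case True
      then show ?thesis
        using sff_density_bound[OF card True] pos[OF True] volume_density_nonneg[OF True]
        unfolding sff_norm_catenoid[OF card True nu inj]
        by (simp add: C_def ennreal_mult[symmetric] ennreal_leI)
    qed simp
  qed
  also have "\<dots> = ennreal C * emeasure lborel ?A"
    by (rule nn_integral_cmult_indicator) (simp add: annulus_borel)
  also have "\<dots> < \<infinity>"
  proof -
    have "emeasure lborel ?A \<le> emeasure lborel (ball (0::real^'n) (exp T))"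
      by (rule emeasure_mono) (auto simp: annulus_def)
    also have "\<dots> < \<infinity>" by (rule emeasure_lborel_ball_finite)
    finally show ?thesis by (simp add: ennreal_mult_less_top)
  qed
  finally show ?thesis using meas by (intro integrableI_bounded) auto
qed

text \<open>In particular the absolute value of the Gauss curvature is at least 1.\<close>

lemma gauss_curvature_catenoid:
  fixes y :: "real^'n"
  assumes card: "CARD('n) = 2" "CARD('n) = Suc k" and y: "y \<in> annulus T"
    and inj: "inj_on (catenoid_chart f) (annulus T :: (real^'n) set)"
  shows "catenoid_gauss_curvature T f (catenoid_chart f y) =
    - (1 + (sinh a)\<^sup>2 / sinh (f (ln (norm y))) ^ 4)"
proof -
  have k: "k = 1" using card by simp
  interpret first_integral_profile T f f' "\<lambda>t. real k * (cosh (f t) / sinh (f t)) * (1 + (f' t)\<^sup>2)" "(sinh a)\<^sup>2"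
  proof
    show "(sinh a)\<^sup>2 > 0" using a_pos by simp
    fix t assume "t \<in> {-T<..<T}"
    then show "(sinh a)\<^sup>2 * (1 + (f' t)\<^sup>2) = (sinh (f t))\<^sup>2"
      using first_integral[of t] a_pos by (simp add: k power_divide)
  qed
  define t where "t = ln (norm y)"
  have t: "t \<in> {-T<..<T}" using annulus_D[OF y] by (simp add: t_def)
  define S where "S = sinh (f t)"
  define A where "A = (sinh a)\<^sup>2"
  have S: "S > 0" using f_pos[OF t] by (simp add: S_def)
  have fi: "A * (1 + (f' t)\<^sup>2) = S\<^sup>2"
    using first_integral[OF t] a_pos by (simp add: k power_divide A_def S_def)
  have c: "(cosh (f t))\<^sup>2 = 1 + S\<^sup>2" by (simp add: cosh_square_eq S_def add.commute)
  have "A * m' t = ((cosh (f t))\<^sup>2 * (A * (1 + (f' t)\<^sup>2)) - A * (f' t)\<^sup>2) / S\<^sup>2"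
    unfolding m'_def unfolding k S_def[symmetric] using S by (simp add: power2_eq_square field_simps)
  also have "A * (f' t)\<^sup>2 = S\<^sup>2 - A" using fi by (simp add: algebra_simps)
  also have "((cosh (f t))\<^sup>2 * (A * (1 + (f' t)\<^sup>2)) - (S\<^sup>2 - A)) / S\<^sup>2 = (S ^ 4 + A) / S\<^sup>2"
    unfolding fi c by (simp add: algebra_simps eval_nat_numeral)
  finally have "- A * m' t / S\<^sup>2 = - (1 + A / S ^ 4)"
    using S by (simp add: field_simps eval_nat_numeral)
  then show ?thesis
    unfolding catenoid_gauss_curvature_def surface_gauss_curvature_def the_inv_into_f_f[OF inj y]
      gauss_curvature_chart[OF card(1) y] by (simp add: A_def S_def t_def)
qed

lemma total_intrinsic_curvature_infinite:
  assumes card: "CARD('n) = 2" "CARD('n) = Suc k" and max: "maximal_profile (Suc k) a T f"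
    and inj: "inj_on (catenoid_chart f) (annulus T :: (real^'n) set)"
  shows "(\<integral>\<^sup>+ p. ennreal \<bar>catenoid_gauss_curvature T f (p :: (real^'n) \<times> real)\<bar> \<partial>catenoid_measure T f) = \<infinity>"
proof -
  let ?M = "catenoid_measure T f :: ((real^'n) \<times> real) measure"
  have "\<infinity> = (\<integral>\<^sup>+ p. 1 \<partial>?M)"
    using catenoid_volume_infinite[OF card(2) max] by (simp add: space_catenoid_measure)
  also have "\<dots> \<le> (\<integral>\<^sup>+ p. ennreal \<bar>catenoid_gauss_curvature T f p\<bar> \<partial>?M)"
  proof (rule nn_integral_mono)
    fix p assume "p \<in> space ?M"
    then obtain y where y: "y \<in> annulus T" "p = catenoid_chart f y"
      by (auto simp: space_catenoid_measure catenoid_chart_image[symmetric])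
    have "0 \<le> (sinh a)\<^sup>2 / sinh (f (ln (norm y))) ^ 4" by simp
    then have "1 \<le> \<bar>- (1 + (sinh a)\<^sup>2 / sinh (f (ln (norm y))) ^ 4)\<bar>" by linarith
    then show "1 \<le> ennreal \<bar>catenoid_gauss_curvature T f p\<bar>"
      unfolding y(2) gauss_curvature_catenoid[OF card y(1) inj] by (simp only: ennreal_ge_1)
  qed
  finally show ?thesis by (simp add: top_unique)
qed

end

theorem proposition3p3:
  fixes a T :: real and f :: "real \<Rightarrow> real"
    and \<nu> :: "(real^'n) \<times> real \<Rightarrow> (real^'n) \<times> real"
  assumes "CARD('n) \<ge> 2" and "a > 0" and "T > 0"
    and "maximal_profile CARD('n) a T f"
    and "catenoid_unit_normal T f \<nu>"
  shows "emeasure (catenoid_measure T f) (catenoid T f :: ((real^'n) \<times> real) set) = \<infinity> \<and>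
    integrable (catenoid_measure T f) (\<lambda>p. (catenoid_sff_norm T f \<nu> p) ^ CARD('n)) \<and>
    (CARD('n) = 2 \<longrightarrow>
      (\<integral>\<^sup>+ p. ennreal \<bar>catenoid_gauss_curvature T f (p :: (real^'n) \<times> real)\<bar>
         \<partial>catenoid_measure T f) = \<infinity>)"
proof -
  define k where "k = CARD('n) - 1"
  have card: "CARD('n) = Suc k" and k: "k \<ge> 1" using assms(1) by (auto simp: k_def)
  have sol: "profile_solution CARD('n) a {-T<..<T} f"
    using assms(4) by (simp add: maximal_profile_def)
  then obtain f' where f': "f 0 = a" "f' 0 = 0"
    "\<And>t. t \<in> {-T<..<T} \<Longrightarrow> f t > 0 \<and> (f has_real_derivative f' t) (at t) \<and>
       (f' has_real_derivative (real CARD('n) - 1) * (cosh (f t) / sinh (f t)) * (1 + (f' t)\<^sup>2)) (at t)"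
    unfolding profile_solution_def by blast
  interpret catenoid_profile k T f f' a
    using f' k assms(2,3) by unfold_locales (auto simp: card)
  have max: "maximal_profile (Suc k) a T f" using assms(4) by (simp add: card)
  note inj = catenoid_chart_inj[OF sol]
  show ?thesis
    using catenoid_volume_infinite[OF card max] total_extrinsic_curvature_finite[OF card assms(5) inj]
      total_intrinsic_curvature_infinite[OF _ card max inj] by blast
qed

end
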